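(* Let $m\geq 1$ and let $\mathcal{P}_m$ be the manifold of real symmetric positive definite $m\times m$ matrices equipped with the trace (affine invariant) metric. Let $p\in\mathcal{P}_m$, let $z\in T_p\mathcal{P}_m$ be a unit vector, and let $\xi$ be the unique point of the boundary at infinity $\partial\mathcal{P}_m$ satisfying $\xi_p=z$. Take any eigendecomposition $VDV^T$ of the symmetric matrix $p^{-1/2}\xi_p p^{-1/2}$ (with $V$ an orthogonal matrix) such that $D=\mathrm{diag}(d_1,\ldots,d_m)$ satisfies $d_1\geq\cdots\geq d_m$. Take any $x\in\mathcal{P}_m$. Denote the columns of the matrix $W:=x^{-1/2}p^{1/2}V$ by $w_1,\ldots,w_m$, and let $u_1,\ldots,u_m$ be an orthonormal basis of $\mathbb{R}^m$ (with the Euclidean inner product) that results from applying the Gram-Schmidt orthonormalization process to $w_1,\ldots,w_m$ (in this order). Then $$\xi_x=x^{1/2}UDU^Tx^{1/2},\qquad\text{where } U:=[u_1,\ldots,u_m].$$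
   Context: $\mathcal{S}_m$ is the vector space of real symmetric $m\times m$ matrices and $\mathcal{P}_m$ the space of real symmetric positive definite $m\times m$ matrices, a smooth manifold of dimension $m(m+1)/2$ with $T_x\mathcal{P}_m\cong\mathcal{S}_m$ at each $x$. The trace metric is $\langle v_1,v_2\rangle=\mathrm{tr}(x^{-1}v_1x^{-1}v_2)$ for $v_1,v_2\in T_x\mathcal{P}_m$; with it, $\mathcal{P}_m$ is a Hadamard manifold (complete, simply connected, non-positive sectional curvature). "Unit vector" in $T_p\mathcal{P}_m$ is with respect to this metric. For $x\in\mathcal{P}_m$, $x^{1/2}$ is the unique symmetric positive definite square root and $x^{-1/2}$ its inverse. With this metric the Riemannian exponential map is $\exp_x(v)=x^{1/2}\mathrm{Exp}(x^{-1/2}vx^{-1/2})x^{1/2}$, its inverse is $\log_x(p)=x^{1/2}\mathrm{Log}(x^{-1/2}px^{-1/2})x^{1/2}$, and the distance is $d(x,p)=\lVert\mathrm{Log}(x^{-1/2}px^{-1/2})\rVert_F$, where $\mathrm{Exp}$ is the matrix exponential, $\mathrm{Log}$ is the symmetric matrix logarithm of a symmetric positive definite matrix, and $\lVert\cdot\rVert_F$ is the Frobenius norm. Boundary at infinity and radial fields: in a Hadamard manifold $M$ with distance $d$, two unit-speed geodesic rays $\gamma_1,\gamma_2:[0,\infty)\to M$ are asymptotic if $t\mapsto d(\gamma_1(t),\gamma_2(t))$ is bounded on $[0,\infty)$. This is an equivalence relation, and $\partial M$ is the set of its equivalence classes. For every $\xi\in\partial M$ and $x\in M$ there is a unique ray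 $\gamma_x\in\xi$ with $\gamma_x(0)=x$; put $\xi_x:=\gamma_x'(0)\in T_xM$, a unit vector. The vector field $x\mapsto\xi_x$ is called the radial field of $\xi$. *)

theory Defs
  imports "HOL-Analysis.Analysis"
begin

text \<open>
  Matrices of size \<open>m\<close> are elements of \<open>real ^ 'n ^ 'n\<close> with \<open>m = CARD('n)\<close>.  Where the order of
  rows and columns matters, \<open>'n\<close> is in addition of class \<open>linorder\<close>: an arbitrary finite linearly
  ordered index type takes the place of \<open>{1, \<dots>, m}\<close>.
\<close>

section \<open>Positive definite matrices and the trace metric\<close>

definition sym_matrices :: "(real ^ 'n ^ 'n) set" where
  "sym_matrices = {v. transpose v = v}"

definition spd_matrices :: "(real ^ 'n ^ 'n) set" where
  "spd_matrices = {x \<in> sym_matrices. \<forall>v. v \<noteq> 0 \<longrightarrow> v \<bullet> (x *v v) > 0}"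

definition spd_sqrt :: "real ^ 'n ^ 'n \<Rightarrow> real ^ 'n ^ 'n" where
  "spd_sqrt x = (THE y. y \<in> spd_matrices \<and> y ** y = x)"

text \<open>Every tangent space of the open subset \<open>spd_matrices\<close> of \<open>sym_matrices\<close> is identified
  with \<open>sym_matrices\<close>.\<close>

definition trace_metric :: "real ^ 'n ^ 'n \<Rightarrow> real ^ 'n ^ 'n \<Rightarrow> real ^ 'n ^ 'n \<Rightarrow> real" where
  "trace_metric x v1 v2 = trace (matrix_inv x ** v1 ** matrix_inv x ** v2)"

definition unit_tangent :: "real ^ 'n ^ 'n \<Rightarrow> (real ^ 'n ^ 'n) set" where
  "unit_tangent x = {v \<in> sym_matrices. trace_metric x v v = 1}"

section \<open>Riemannian distance\<close>

definition speed :: "(real \<Rightarrow> real ^ 'n ^ 'n) \<Rightarrow> real \<Rightarrow> real" where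
  "speed g t = sqrt (trace_metric (g t) (vector_derivative g (at t)) (vector_derivative g (at t)))"

text \<open>Piecewise \<open>C\<^sup>1\<close> curves.  The library's notion does not bound the velocity near the
  exceptional points, so a curve might have infinite length, to which the total function
  \<open>integral\<close> would assign \<open>0\<close>; integrability of the speed excludes this.\<close>

definition spd_curves :: "real ^ 'n ^ 'n \<Rightarrow> real ^ 'n ^ 'n \<Rightarrow> (real \<Rightarrow> real ^ 'n ^ 'n) set" where
  "spd_curves x y = {g. valid_path g \<and> path_image g \<subseteq> spd_matrices \<and>
     pathstart g = x \<and> pathfinish g = y \<and> speed g integrable_on {0..1}}"

definition spd_dist :: "real ^ 'n ^ 'n \<Rightarrow> real ^ 'n ^ 'n \<Rightarrow> real" where
  "spd_dist x y = (INF g \<in> spd_curves x y. integral {0..1} (speed g))"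

section \<open>Geodesic rays\<close>

definition metric_deriv ::
    "real ^ 'n ^ 'n \<Rightarrow> real ^ 'n ^ 'n \<Rightarrow> real ^ 'n ^ 'n \<Rightarrow> real ^ 'n ^ 'n \<Rightarrow> real" where
  "metric_deriv x u v w = deriv (\<lambda>s. trace_metric (x + s *\<^sub>R u) v w) 0"

text \<open>The Christoffel map of the Levi-Civita connection in the global chart \<open>sym_matrices\<close>:
  the Koszul formula for constant vector fields \<open>u\<close>, \<open>v\<close>, \<open>w\<close>, whose brackets vanish.\<close>

definition christoffel ::
    "real ^ 'n ^ 'n \<Rightarrow> real ^ 'n ^ 'n \<Rightarrow> real ^ 'n ^ 'n \<Rightarrow> real ^ 'n ^ 'n" where
  "christoffel x u v = (THE c. c \<in> sym_matrices \<and>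
     (\<forall>w \<in> sym_matrices. 2 * trace_metric x c w =
        metric_deriv x u v w + metric_deriv x v u w - metric_deriv x w u v))"

text \<open>Unit-speed geodesic rays \<open>[0, \<infinity>) \<rightarrow> spd_matrices\<close>, that is, solutions of the geodesic equation
  \<open>\<gamma>'' + \<Gamma>(\<gamma>', \<gamma>') = 0\<close>.  They are taken to be \<open>undefined\<close> at negative arguments, so that a
  ray is determined by its values on \<open>[0, \<infinity>)\<close>.\<close>

definition geodesic_rays :: "(real \<Rightarrow> real ^ 'n ^ 'n) set" where
  "geodesic_rays = {\<gamma> \<in> {0..} \<rightarrow>\<^sub>E spd_matrices. \<exists>\<gamma>' \<gamma>''. \<forall>t\<ge>0.
     (\<gamma> has_vector_derivative \<gamma>' t) (at t within {0..}) \<and>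
     (\<gamma>' has_vector_derivative \<gamma>'' t) (at t within {0..}) \<and>
     \<gamma>'' t + christoffel (\<gamma> t) (\<gamma>' t) (\<gamma>' t) = 0 \<and>
     \<gamma>' t \<in> unit_tangent (\<gamma> t)}"

section \<open>Boundary at infinity and radial fields\<close>

definition asymptotic :: "((real \<Rightarrow> real ^ 'n ^ 'n) \<times> (real \<Rightarrow> real ^ 'n ^ 'n)) set" where
  "asymptotic = {(\<gamma>1, \<gamma>2). \<gamma>1 \<in> geodesic_rays \<and> \<gamma>2 \<in> geodesic_rays \<and>
     bounded ((\<lambda>t. spd_dist (\<gamma>1 t) (\<gamma>2 t)) ` {0..})}"

definition boundary_at_infinity :: "(real \<Rightarrow> real ^ 'n ^ 'n) set set" where
  "boundary_at_infinity = geodesic_rays // asymptotic"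

definition ray_from ::
    "(real \<Rightarrow> real ^ 'n ^ 'n) set \<Rightarrow> real ^ 'n ^ 'n \<Rightarrow> real \<Rightarrow> real ^ 'n ^ 'n" where
  "ray_from \<xi> x = (THE \<gamma>. \<gamma> \<in> \<xi> \<and> \<gamma> 0 = x)"

definition radial_field :: "(real \<Rightarrow> real ^ 'n ^ 'n) set \<Rightarrow> real ^ 'n ^ 'n \<Rightarrow> real ^ 'n ^ 'n" where
  "radial_field \<xi> x = vector_derivative (ray_from \<xi> x) (at 0 within {0..})"

section \<open>Diagonal matrices and the Gram-Schmidt process\<close>

definition diag_matrix :: "('n \<Rightarrow> real) \<Rightarrow> real ^ 'n ^ 'n" where
  "diag_matrix d = (\<chi> i j. if i = j then d i else 0)"

function gram_schmidt ::
    "('n::{finite,linorder} \<Rightarrow> 'a::real_inner) \<Rightarrow> 'n \<Rightarrow> 'a" where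
  "gram_schmidt w k =
     (let v = w k - (\<Sum>j\<in>{..<k}. (w k \<bullet> gram_schmidt w j) *\<^sub>R gram_schmidt w j)
      in v /\<^sub>R norm v)"
  by pat_completeness auto
termination
  by (relation "Wellfounded.measure (\<lambda>(w, k). card {..<k})")
     (auto intro!: psubset_card_mono)

declare gram_schmidt.simps [simp del]

end

theory Submission
  imports Defs
begin

text \<open>
  Along a geodesic \<open>\<gamma>\<close> the matrix \<open>\<gamma>\<^sup>-\<^sup>1 \<gamma>'\<close> is constant, so simultaneous diagonalization of
  \<open>\<gamma> 0\<close> and \<open>\<gamma>' 0\<close> puts every ray into the form \<open>G\<^sup>T exp (t D) G\<close> with \<open>D\<close> diagonal and sorted.
  For each vector \<open>v\<close> the function \<open>x \<mapsto> ln (v \<bullet> x v)\<close> is 1-Lipschitz for the Riemannian distance,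
  and conversely the distance is bounded in terms of these functions through an explicit geodesic
  from \<open>x\<close> to \<open>y\<close>.  Hence two rays are asymptotic iff their quadratic forms are comparable
  uniformly in \<open>t\<close>.  Comparing growth rates shows that asymptotic rays with the same origin agree.
  For existence, Gram-Schmidt yields \<open>x\<^sup>-\<^sup>1\<^sup>/\<^sup>2 G\<^sup>T = U R\<close> with \<open>R\<close> upper triangular, so that
  \<open>G = R\<^sup>T H\<close> for \<open>H = U\<^sup>T x\<^sup>1\<^sup>/\<^sup>2\<close>.  As \<open>D\<close> is sorted, \<open>exp (- t D / 2) R exp (t D / 2)\<close> and its
  inverse stay bounded for \<open>t \<ge> 0\<close>, and \<open>H\<^sup>T exp (t D) H\<close> is the ray from \<open>x\<close> asymptotic to the
  given one.
\<close>

section \<open>Matrix algebra and calculus\<close>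

lemma matrix_inv_mult:
  assumes "invertible A"
  shows matrix_inv_right: "A ** matrix_inv A = mat 1"
    and matrix_inv_left: "matrix_inv A ** A = mat 1"
  using someI_ex[OF assms[unfolded invertible_def]] unfolding matrix_inv_def by auto

lemma matrix_inv_unique:
  fixes A B :: "real ^ 'n ^ 'n"
  assumes "A ** B = mat 1"
  shows "matrix_inv A = B"
proof -
  have "invertible A" using assms invertible_right_inverse by blast
  then have "matrix_inv A ** (A ** B) = B"
    by (simp add: matrix_mul_assoc matrix_inv_left)
  then show ?thesis using assms by simp
qed

lemma invertible_matrix_inv:
  fixes A :: "real ^ 'n ^ 'n"
  assumes "invertible A"
  shows "invertible (matrix_inv A)"
  using matrix_inv_mult[OF assms] invertible_def by blast

lemma matrix_inv_transpose:
  fixes A :: "real ^ 'n ^ 'n"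
  assumes "invertible A"
  shows "matrix_inv (transpose A) = transpose (matrix_inv A)"
  by (rule matrix_inv_unique)
    (metis assms matrix_inv_left matrix_transpose_mul transpose_mat)

lemma inv_cancel:
  fixes G X :: "real ^ 'n ^ 'n"
  assumes "invertible G"
  shows "G ** matrix_inv G = mat 1" "matrix_inv G ** G = mat 1"
    "X ** G ** matrix_inv G = X" "X ** matrix_inv G ** G = X"
    "transpose G ** transpose (matrix_inv G) = mat 1"
    "transpose (matrix_inv G) ** transpose G = mat 1"
    "X ** transpose G ** transpose (matrix_inv G) = X"
    "X ** transpose (matrix_inv G) ** transpose G = X"
proof -
  note i = matrix_inv_mult[OF assms]
  have t: "transpose G ** transpose (matrix_inv G) = mat 1"
    "transpose (matrix_inv G) ** transpose G = mat 1"
    by (simp_all add: i flip: matrix_transpose_mul)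
  show "G ** matrix_inv G = mat 1" "matrix_inv G ** G = mat 1"
    "X ** G ** matrix_inv G = X" "X ** matrix_inv G ** G = X"
    "transpose G ** transpose (matrix_inv G) = mat 1"
    "transpose (matrix_inv G) ** transpose G = mat 1"
    "X ** transpose G ** transpose (matrix_inv G) = X"
    "X ** transpose (matrix_inv G) ** transpose G = X"
    using i t by (simp_all flip: matrix_mul_assoc)
qed

lemma orthogonal_matrix_inv:
  fixes Q :: "real ^ 'n ^ 'n"
  assumes "orthogonal_matrix Q"
  shows "matrix_inv Q = transpose Q" "invertible Q"
  using assms matrix_inv_unique invertible_def unfolding orthogonal_matrix_def by blast+

lemma inner_matrix_mult:
  fixes A :: "real ^ 'n ^ 'm"
  shows "v \<bullet> (transpose A *v w) = (A *v v) \<bullet> w"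
  by (metis dot_lmul_matrix inner_commute transpose_matrix_vector)

section \<open>Products with diagonal matrices\<close>

lemma diag_matrix_mult_vec: "(diag_matrix d *v v) $ i = d i * v $ i"
proof -
  have "(diag_matrix d *v v) $ i = (\<Sum>j\<in>UNIV. if j = i then d i * v $ i else 0)"
    by (simp add: diag_matrix_def matrix_vector_mult_def if_distrib[of "\<lambda>a. a * _"] eq_commute[of i] cong: if_cong)
  then show ?thesis by simp
qed

lemma diag_matrix_mult_left: "(diag_matrix d ** A) $ i $ j = d i * A $ i $ j"
proof -
  have "(diag_matrix d ** A) $ i $ j = (\<Sum>k\<in>UNIV. if k = i then d i * A $ i $ j else 0)"
    by (simp add: diag_matrix_def matrix_matrix_mult_def if_distrib[of "\<lambda>a. a * _"]
        if_distrib[of "\<lambda>a. _ * a"] eq_commute[of i] cong: if_cong)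
  then show ?thesis by simp
qed

lemma diag_matrix_mult_right: "(A ** diag_matrix d) $ i $ j = A $ i $ j * d j"
proof -
  have "(A ** diag_matrix d) $ i $ j = (\<Sum>k\<in>UNIV. if k = j then A $ i $ j * d j else 0)"
    by (simp add: diag_matrix_def matrix_matrix_mult_def if_distrib[of "\<lambda>a. a * _"]
        if_distrib[of "\<lambda>a. _ * a"] eq_commute[of i] cong: if_cong)
  then show ?thesis by simp
qed

lemma diag_matrix_mult: "diag_matrix a ** diag_matrix b = diag_matrix (\<lambda>i. a i * b i)"
  by (simp add: vec_eq_iff diag_matrix_mult_left) (simp add: diag_matrix_def)

lemma diag_matrix_1: "diag_matrix (\<lambda>i. 1) = mat 1"
  by (simp add: diag_matrix_def mat_def)

lemma transpose_diag_matrix [simp]: "transpose (diag_matrix d) = diag_matrix d"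
  by (auto simp: diag_matrix_def transpose_def vec_eq_iff)

lemma trace_diag_matrix: "trace (diag_matrix d) = sum d UNIV"
  by (simp add: trace_def diag_matrix_def)

section \<open>Continuity and differentiation of matrix-valued functions\<close>

lemma bounded_bilinear_matrix_mult:
  "bounded_bilinear (\<lambda>A B :: real ^ 'n ^ 'n. A ** B)"
  unfolding bilinear_conv_bounded_bilinear[symmetric] bilinear_def
  by (auto intro!: linearI simp: vec_eq_iff matrix_matrix_mult_def sum.distrib
      distrib_left distrib_right sum_distrib_left mult_ac)

lemma bounded_linear_trace: "bounded_linear (trace :: real ^ 'n ^ 'n \<Rightarrow> real)"
  by (intro linear_conv_bounded_linear[THEN iffD1] linearI)
    (simp_all add: trace_def sum.distrib sum_distrib_left)

lemma bounded_linear_transpose: "bounded_linear (transpose :: real ^ 'n ^ 'n \<Rightarrow> real ^ 'n ^ 'n)"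
  by (intro linear_conv_bounded_linear[THEN iffD1] linearI) (simp_all add: transpose_def vec_eq_iff)

lemmas has_vector_derivative_matrix_mult =
  bounded_bilinear.has_vector_derivative[OF bounded_bilinear_matrix_mult]
lemmas matrix_mult_simps =
  bounded_bilinear.add_left[OF bounded_bilinear_matrix_mult]
  bounded_bilinear.add_right[OF bounded_bilinear_matrix_mult]
  bounded_bilinear.minus_left[OF bounded_bilinear_matrix_mult]
  bounded_bilinear.minus_right[OF bounded_bilinear_matrix_mult]
  bounded_bilinear.diff_left[OF bounded_bilinear_matrix_mult]
  bounded_bilinear.diff_right[OF bounded_bilinear_matrix_mult]
  bounded_bilinear.zero_left[OF bounded_bilinear_matrix_mult]
  bounded_bilinear.zero_right[OF bounded_bilinear_matrix_mult]
lemmas tendsto_matrix_mult = bounded_bilinear.tendsto[OF bounded_bilinear_matrix_mult]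

lemma trace_minus: "trace (- A) = - trace (A :: real ^ 'n ^ 'n)"
  by (rule linear_neg[OF bounded_linear.linear[OF bounded_linear_trace]])

lemma transpose_diff: "transpose (A - B) = transpose A - transpose (B :: real ^ 'n ^ 'n)"
  by (rule linear_diff[OF bounded_linear.linear[OF bounded_linear_transpose]])

lemma transpose_minus: "transpose (- A) = - transpose (A :: real ^ 'n ^ 'n)"
  by (rule linear_neg[OF bounded_linear.linear[OF bounded_linear_transpose]])

lemma tendsto_det:
  fixes A :: "'a \<Rightarrow> real ^ 'n ^ 'n"
  assumes "(A \<longlongrightarrow> L) F"
  shows "((\<lambda>s. det (A s)) \<longlongrightarrow> det L) F"
  unfolding det_def by (intro tendsto_intros assms)

text \<open>Cramer's rule applied to each column of the inverse. It replaces the choice operator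
  behind \<open>matrix_inv\<close> by quotients of determinants, whose continuity is
  immediate.\<close>

lemma matrix_inv_cramer:
  fixes A :: "real ^ 'n ^ 'n"
  assumes "det A \<noteq> 0"
  shows "matrix_inv A =
    (\<chi> k l. det (\<chi> i j. if j = k then mat 1 $ i $ l else A $ i $ j) / det A)"
proof -
  have "A ** matrix_inv A = mat 1"
    using assms by (simp add: invertible_det_nz matrix_inv_right)
  then have "A *v column l (matrix_inv A) = column l (mat 1)" for l
    by (metis matrix_vector_mul_assoc matrix_vector_mult_basis)
  then have "column l (matrix_inv A)
      = (\<chi> k. det (\<chi> i j. if j = k then column l (mat 1) $ i else A $ i $ j) / det A)" for l
    using cramer[OF assms] by blast
  from this[unfolded vec_eq_iff column_def vec_lambda_beta] show ?thesis
    by (simp add: vec_eq_iff)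
qed

lemma tendsto_matrix_inv:
  fixes A :: "'a \<Rightarrow> real ^ 'n ^ 'n"
  assumes A: "(A \<longlongrightarrow> L) F" and L: "invertible L"
  shows "((\<lambda>s. matrix_inv (A s)) \<longlongrightarrow> matrix_inv L) F"
proof -
  have nz: "det L \<noteq> 0" using L invertible_det_nz by blast
  have "\<forall>\<^sub>F s in F. det (A s) \<noteq> 0"
    using tendsto_imp_eventually_ne[OF tendsto_det[OF A] nz] .
  then have ev: "\<forall>\<^sub>F s in F. matrix_inv (A s) =
      (\<chi> k l. det (\<chi> i j. if j = k then mat 1 $ i $ l else A s $ i $ j) / det (A s))"
    by eventually_elim (rule matrix_inv_cramer)
  have "((\<lambda>s. \<chi> i j. if j = k then (mat 1 :: real ^ 'n ^ 'n) $ i $ l else A s $ i $ j) \<longlongrightarrow>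
      (\<chi> i j. if j = k then mat 1 $ i $ l else L $ i $ j)) F" for k l
    by (intro vec_tendstoI) (auto intro!: tendsto_vec_nth A)
  then have "((\<lambda>s. \<chi> k l. det (\<chi> i j. if j = k then mat 1 $ i $ l else A s $ i $ j) / det (A s)) \<longlongrightarrow>
      (\<chi> k l. det (\<chi> i j. if j = k then mat 1 $ i $ l else L $ i $ j) / det L)) F"
    by (intro vec_tendstoI) (auto intro!: tendsto_divide tendsto_det A nz)
  then show ?thesis
    unfolding matrix_inv_cramer[OF nz] using tendsto_cong[OF ev] by blast
qed

text \<open>For a real variable the derivative is the limit of difference quotients; in this form
  the limit rules for products and inverses of matrices apply directly.\<close>

lemma has_vector_derivative_iff_tendsto:
  "(f has_vector_derivative D) (at x within S) \<longleftrightarrow>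
    ((\<lambda>y. (f y - f x) /\<^sub>R (y - x)) \<longlongrightarrow> D) (at x within S)"
proof -
  have "norm ((f y - f x - (y - x) *\<^sub>R D) /\<^sub>R norm (y - x)) = norm ((f y - f x) /\<^sub>R (y - x) - D)"
    if "y \<noteq> x" for y
  proof -
    have "(f y - f x) /\<^sub>R (y - x) - D = (f y - f x - (y - x) *\<^sub>R D) /\<^sub>R (y - x)"
      using that by (simp add: scaleR_diff_right)
    then show ?thesis by simp
  qed
  then have "((\<lambda>y. norm ((f y - f x - (y - x) *\<^sub>R D) /\<^sub>R norm (y - x))) \<longlongrightarrow> 0) (at x within S)
    \<longleftrightarrow> ((\<lambda>y. norm ((f y - f x) /\<^sub>R (y - x) - D)) \<longlongrightarrow> 0) (at x within S)"
    by (intro tendsto_cong) (auto simp: eventually_at_filter)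
  then have "((\<lambda>y. (f y - f x - (y - x) *\<^sub>R D) /\<^sub>R norm (y - x)) \<longlongrightarrow> 0) (at x within S)
    \<longleftrightarrow> ((\<lambda>y. (f y - f x) /\<^sub>R (y - x)) \<longlongrightarrow> D) (at x within S)"
    by (simp only: tendsto_norm_zero_iff LIM_zero_iff)
  then show ?thesis
    unfolding has_vector_derivative_def has_derivative_within
    by (simp add: bounded_linear_scaleR_left diff_diff_eq[symmetric] divide_inverse_commute)
qed

text \<open>The resolvent-type identity expressing
  \<open>matrix_inv (A t) - matrix_inv (A s)\<close> as
  \<open>matrix_inv (A s) ** (A s - A t) ** matrix_inv (A t)\<close> turns the difference quotient
  into a product, whose limit follows from continuity of inversion.\<close>

lemma has_vector_derivative_matrix_inv:
  fixes A :: "real \<Rightarrow> real ^ 'n ^ 'n"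
  assumes A: "(A has_vector_derivative A') (at t within S)" and inv: "invertible (A t)"
  shows "((\<lambda>s. matrix_inv (A s)) has_vector_derivative
    - (matrix_inv (A t) ** A' ** matrix_inv (A t))) (at t within S)"
proof -
  have lim: "(A \<longlongrightarrow> A t) (at t within S)"
    using has_vector_derivative_continuous[OF A] by (simp add: continuous_within)
  have "\<forall>\<^sub>F s in at t within S. det (A s) \<noteq> 0"
    using tendsto_imp_eventually_ne[OF tendsto_det[OF lim]] inv invertible_det_nz by blast
  then have ev: "\<forall>\<^sub>F s in at t within S. - (matrix_inv (A s) ** ((A s - A t) /\<^sub>R (s - t)) ** matrix_inv (A t))
      = (matrix_inv (A s) - matrix_inv (A t)) /\<^sub>R (s - t)"
  proof eventually_elim
    case (elim s)
    then have i: "invertible (A s)" by (simp add: invertible_det_nz)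
    have "matrix_inv (A s) ** (A s - A t) ** matrix_inv (A t) = matrix_inv (A t) - matrix_inv (A s)"
      by (simp add: i inv inv_cancel bounded_bilinear.diff_left[OF bounded_bilinear_matrix_mult]
        bounded_bilinear.diff_right[OF bounded_bilinear_matrix_mult])
    then show ?case
      by (simp add: bounded_bilinear.scaleR_left[OF bounded_bilinear_matrix_mult]
        bounded_bilinear.scaleR_right[OF bounded_bilinear_matrix_mult] flip: scaleR_minus_right)
  qed
  have "((\<lambda>s. - (matrix_inv (A s) ** ((A s - A t) /\<^sub>R (s - t)) ** matrix_inv (A t))) \<longlongrightarrow>
    - (matrix_inv (A t) ** A' ** matrix_inv (A t))) (at t within S)"
    using A unfolding has_vector_derivative_iff_tendsto
    by (intro tendsto_minus tendsto_matrix_mult tendsto_matrix_inv lim inv tendsto_const)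
  then show ?thesis
    unfolding has_vector_derivative_iff_tendsto using tendsto_cong[OF ev] by blast
qed

section \<open>Diagonalization of symmetric matrices\<close>

lemma sym_matrices_inner:
  fixes A :: "real ^ 'n ^ 'n"
  assumes "A \<in> sym_matrices"
  shows "v \<bullet> (A *v w) = w \<bullet> (A *v v)"
  using inner_matrix_mult[of v A w] assms by (simp add: sym_matrices_def inner_commute del: transpose_matrix_vector)

lemma spd_matrices_sym: "x \<in> spd_matrices \<Longrightarrow> x \<in> sym_matrices"
  by (simp add: spd_matrices_def)

lemma invertible_spd:
  fixes x :: "real ^ 'n ^ 'n"
  assumes "x \<in> spd_matrices"
  shows "invertible x"
proof -
  have "v = 0" if "x *v v = 0" for v
    using that assms unfolding spd_matrices_def by force
  then show ?thesis
    using matrix_left_invertible_ker[of x] invertible_left_inverse by blast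
qed

text \<open>The index \<open>k\<close> itself is missing from \<open>{..<k}\<close>, so the
  constraints span a proper subspace. This makes the feasible set of the Rayleigh maximization
  nonempty.\<close>

lemma unit_orthogonal_exists:
  fixes f :: "'n::{finite,linorder} \<Rightarrow> real ^ 'n::{finite,linorder}"
  obtains v where "norm v = 1" "\<And>j. j < k \<Longrightarrow> v \<bullet> f j = 0"
proof -
  have "card {..<k} < CARD('n)"
    by (rule psubset_card_mono) auto
  then have "dim (f ` {..<k}) < DIM(real ^ 'n::{finite,linorder})"
    using dim_le_card'[of "f ` {..<k}"] card_image_le[of "{..<k}" f] by auto
  then obtain w where w: "w \<noteq> 0" "\<And>y. y \<in> span (f ` {..<k}) \<Longrightarrow> orthogonal w y"
    using orthogonal_to_subspace_exists by blast
  have "(w /\<^sub>R norm w) \<bullet> f j = 0" if "j < k" for j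
    using w(2)[of "f j"] that by (simp add: orthogonal_def span_base)
  with w(1) show ?thesis by (intro that[of "w /\<^sub>R norm w"]) auto
qed

lemma continuous_on_matrix_vec: "continuous_on S (\<lambda>v. A *v v)" for A :: "real ^ 'n ^ 'm"
  by (intro linear_continuous_on matrix_vector_mul_bounded_linear)

lemma rayleigh_maximizer_exists:
  fixes A :: "real ^ 'n::{finite,linorder} ^ 'n::{finite,linorder}" and f :: "'n \<Rightarrow> real ^ 'n::{finite,linorder}"
  shows "\<exists>r. norm r = 1 \<and> (\<forall>j<k. r \<bullet> f j = 0) \<and>
    (\<forall>w. norm w = 1 \<longrightarrow> (\<forall>j<k. w \<bullet> f j = 0) \<longrightarrow> w \<bullet> (A *v w) \<le> r \<bullet> (A *v r))"
proof -
  let ?S = "sphere 0 1 \<inter> (\<Inter>j\<in>{..<k}. {v. v \<bullet> f j = 0})"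
  have "compact ?S"
    by (intro compact_Int_closed compact_sphere closed_INT ballI closed_Collect_eq)
      (intro continuous_intros)+
  moreover have "?S \<noteq> {}"
  proof -
    obtain v where "norm v = 1" "\<And>j. j < k \<Longrightarrow> v \<bullet> f j = 0"
      using unit_orthogonal_exists by metis
    then have "v \<in> ?S" by simp
    then show ?thesis by blast
  qed
  ultimately have "\<exists>r\<in>?S. \<forall>w\<in>?S. w \<bullet> (A *v w) \<le> r \<bullet> (A *v r)"
    by (intro continuous_attains_sup continuous_on_inner continuous_on_id continuous_on_matrix_vec)
  then show ?thesis by auto
qed

text \<open>The columns are chosen by maximizing the Rayleigh quotient successively, so that the
  eigenvalues come out in decreasing order.\<close>

theorem spectral_decomposition:
  fixes A :: "real ^ 'n::{finite,linorder} ^ 'n::{finite,linorder}"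
  assumes A: "A \<in> sym_matrices"
  obtains V d where "orthogonal_matrix V" "antimono d" "A = V ** diag_matrix d ** transpose V"
proof -
  \<comment> \<open>The condition on the vector at index \<open>k\<close> involves \<open>f\<close>
    only at smaller indices, as choice along a well-founded relation requires.\<close>
  define P where "P = (\<lambda>f (k::'n) r. norm r = 1 \<and> (\<forall>j<k. r \<bullet> f j = 0) \<and>
    (\<forall>w. norm w = 1 \<longrightarrow> (\<forall>j<k. w \<bullet> f j = 0) \<longrightarrow> w \<bullet> (A *v w) \<le> r \<bullet> (A *v r)))"
  have "wf {(i, j). i < (j::'n)}"
    by (rule wf_subset[OF wf_measure[of "\<lambda>k. card {..<k}"]]) (auto intro!: psubset_card_mono)
  then have "\<exists>f. \<forall>k. P f k (f k)"
  proof (rule dependent_wf_choice[where P = P])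
    show "P f x r = P g x r" if "\<And>z. (z, x) \<in> {(i, j). i < (j::'n)} \<Longrightarrow> f z = g z" for f g x r
      using that unfolding P_def by simp
    show "\<exists>r. P f x r" for f x
      unfolding P_def by (rule rayleigh_maximizer_exists)
  qed
  then obtain f where f: "\<And>k. P f k (f k)" by blast
  define d where "d k = f k \<bullet> (A *v f k)" for k
  have unit: "norm (f k) = 1" and orth_less: "j < k \<Longrightarrow> f k \<bullet> f j = 0"
    and max: "norm w = 1 \<Longrightarrow> (\<And>j. j < k \<Longrightarrow> w \<bullet> f j = 0) \<Longrightarrow> w \<bullet> (A *v w) \<le> d k" for j k w
    using f[of k] unfolding P_def d_def by auto
  have orth: "j \<noteq> k \<Longrightarrow> f k \<bullet> f j = 0" for j k
    using orth_less[of j k] orth_less[of k j] by (cases j k rule: linorder_cases) (auto simp: inner_commute)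
  \<comment> \<open>First-order condition at the maximizer: perturbing \<open>f k\<close> to
    \<open>f k + s w\<close> within the constraints gives an inequality in \<open>s\<close> whose
    linear coefficient \<open>2 * b\<close> must vanish.\<close>
  have ortho_A: "f k \<bullet> (A *v w) = 0" if w: "w \<bullet> f k = 0" "\<And>j. j < k \<Longrightarrow> w \<bullet> f j = 0" for k w
  proof (rule ccontr)
    assume ne: "f k \<bullet> (A *v w) \<noteq> 0"
    define b where "b = f k \<bullet> (A *v w)"
    define c where "c = w \<bullet> (A *v w) - d k * (w \<bullet> w)"
    have le: "2 * s * b + s\<^sup>2 * c \<le> 0" for s
    proof -
      define y where "y = f k + s *\<^sub>R w"
      have yy: "y \<bullet> y = 1 + s\<^sup>2 * (w \<bullet> w)"
        using unit[of k] w(1) by (simp add: y_def inner_add inner_commute norm_eq_1 power2_eq_square)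
      then have pos: "y \<bullet> y > 0"
        by (simp add: add_pos_nonneg)
      then have y0: "y \<noteq> 0" by auto
      have "(y /\<^sub>R norm y) \<bullet> (A *v (y /\<^sub>R norm y)) \<le> d k"
        by (rule max) (use y0 w orth_less in \<open>auto simp: y_def inner_add\<close>)
      then have "y \<bullet> (A *v y) / (y \<bullet> y) \<le> d k"
        by (simp add: matrix_vector_mult_scaleR field_simps power2_eq_square flip: power2_norm_eq_inner)
      then have "y \<bullet> (A *v y) \<le> d k * (y \<bullet> y)"
        using pos by (simp add: field_simps)
      moreover have "y \<bullet> (A *v y) = d k + 2 * s * b + s\<^sup>2 * (w \<bullet> (A *v w))"
        using sym_matrices_inner[OF A, of w "f k"]
        by (simp add: y_def d_def b_def matrix_vector_right_distrib matrix_vector_mult_scaleR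
            inner_add algebra_simps power2_eq_square)
      ultimately show ?thesis
        unfolding yy c_def by (simp add: algebra_simps)
    qed
    \<comment> \<open>From here to the end of this block \<open>k\<close> is a real number, large
      enough that the choice \<open>s = b / k\<close> makes the quadratic expression positive unless
      \<open>b = 0\<close>.\<close>
    define k where "k = 1 + \<bar>c\<bar>"
    have k: "k > 0" "2 * k + c > 0" by (simp_all add: k_def)
    have "2 * (b / k) * b + (b / k)\<^sup>2 * c = b\<^sup>2 * (2 * k + c) / k\<^sup>2"
      using k by (simp add: field_simps power2_eq_square)
    then have "b\<^sup>2 * (2 * k + c) \<le> 0"
      using le[of "b / k"] k by (simp add: divide_le_0_iff)
    moreover have "b\<^sup>2 > 0" using ne b_def by simp
    ultimately show False
      using k by (simp add: mult_le_0_iff)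
  qed
  have eigen: "A *v f k = d k *\<^sub>R f k" for k
  proof (induction k rule: measure_induct_rule[of "\<lambda>k. card {..<k}"])
    case (less k)
    \<comment> \<open>The residual is orthogonal to the earlier eigenvectors by symmetry of
      \<open>A\<close> and the induction hypothesis, and to \<open>f k\<close> by the choice of
      \<open>d k\<close>. Hence it is itself an admissible perturbation, and \<open>ortho_A\<close>
      forces it to vanish.\<close>
    define w where "w = A *v f k - d k *\<^sub>R f k"
    have "w \<bullet> f j = 0" if "j < k" for j
    proof -
      have "A *v f j = d j *\<^sub>R f j"
        by (rule less) (use that in \<open>auto intro!: psubset_card_mono\<close>)
      then show ?thesis
        using that orth_less[OF that] sym_matrices_inner[OF A, of "f k" "f j"]
        by (simp add: w_def inner_diff inner_commute)
    qed
    moreover have wk: "w \<bullet> f k = 0"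
      using unit[of k] by (simp add: w_def d_def inner_diff inner_commute norm_eq_1)
    ultimately have "f k \<bullet> (A *v w) = 0" by (intro ortho_A)
    then have "w \<bullet> (A *v f k) = 0"
      using sym_matrices_inner[OF A, of w "f k"] by simp
    then have "w \<bullet> w = 0"
      using wk by (subst (2) w_def) (simp add: inner_diff)
    then show ?case by (simp add: w_def)
  qed
  define V :: "real ^ 'n::{finite,linorder} ^ 'n::{finite,linorder}" where "V = (\<chi> i j. f j $ i)"
  have col: "column j V = f j" for j by (simp add: V_def column_def vec_eq_iff)
  have V: "orthogonal_matrix V"
    unfolding orthogonal_matrix_orthonormal_columns col orthogonal_def using unit orth by simp
  have "A ** V = V ** diag_matrix d"
  proof -
    have "(A ** V) $ i $ j = (V ** diag_matrix d) $ i $ j" for i j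
      using arg_cong[OF eigen[of j], of "\<lambda>v. v $ i"] unfolding diag_matrix_mult_right
      by (simp add: V_def matrix_matrix_mult_def matrix_vector_mult_def mult.commute)
    then show ?thesis by (simp add: vec_eq_iff)
  qed
  then have "A = V ** diag_matrix d ** transpose V"
    using V by (metis orthogonal_matrix_def matrix_mul_assoc matrix_mul_rid)
  moreover have "antimono d"
  proof (rule antimonoI)
    fix i j :: 'n assume "i \<le> j"
    \<comment> \<open>The vector \<open>f j\<close> satisfies all constraints of the maximization
      that produced \<open>f i\<close>.\<close>
    then show "d j \<le> d i"
      unfolding d_def[of j] by (intro max unit orth_less) auto
  qed
  ultimately show ?thesis using V that by blast
qed

text \<open>A common normal form for a point and a tangent vector: with \<open>G\<close> invertible
  and fixed, inverses, the trace metric and the geodesic equation become entrywise operations on the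
  function \<open>d\<close>.\<close>

definition congr_diag :: "real ^ 'n ^ 'n \<Rightarrow> ('n \<Rightarrow> real) \<Rightarrow> real ^ 'n ^ 'n" where
  "congr_diag G d = transpose G ** diag_matrix d ** G"

lemma congr_diag_sym: "congr_diag G d \<in> sym_matrices"
  by (simp add: congr_diag_def sym_matrices_def matrix_transpose_mul matrix_mul_assoc)

lemma congr_diag_1: "congr_diag G (\<lambda>i. 1) = transpose G ** G"
  by (simp add: congr_diag_def diag_matrix_1)

lemma quadratic_form_congr_diag:
  "v \<bullet> (congr_diag G d *v v) = (\<Sum>i\<in>UNIV. d i * ((G *v v) $ i)\<^sup>2)"
proof -
  have "v \<bullet> (congr_diag G d *v v) = (G *v v) \<bullet> (diag_matrix d *v (G *v v))"
    unfolding congr_diag_def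
    by (simp add: inner_matrix_mult flip: matrix_vector_mul_assoc del: transpose_matrix_vector)
  then show ?thesis
    by (simp add: inner_vec_def diag_matrix_mult_vec power2_eq_square mult_ac)
qed

lemma invertible_mult_vec_eq_0:
  fixes G :: "real ^ 'n ^ 'n"
  assumes "invertible G" shows "G *v v = 0 \<longleftrightarrow> v = 0"
  using assms matrix_left_invertible_ker[of G] invertible_left_inverse by auto

lemma congr_diag_spd:
  assumes "invertible G" "\<And>i. d i > 0"
  shows "congr_diag G d \<in> spd_matrices"
proof -
  have "v \<bullet> (congr_diag G d *v v) > 0" if v: "v \<noteq> 0" for v
  proof -
    obtain i where "(G *v v) $ i \<noteq> 0"
      using v invertible_mult_vec_eq_0[OF assms(1)] by (metis vec_eq_iff zero_index)
    then show ?thesis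
      unfolding quadratic_form_congr_diag using assms(2)
      by (intro sum_pos2[of _ i]) (auto simp: less_imp_le)
  qed
  then show ?thesis
    by (simp add: spd_matrices_def congr_diag_sym)
qed

lemma matrix_inv_congr_diag:
  assumes "invertible G" "\<And>i. d i \<noteq> 0"
  shows "matrix_inv (congr_diag G d) = congr_diag (transpose (matrix_inv G)) (\<lambda>i. 1 / d i)"
proof (rule matrix_inv_unique)
  have "congr_diag G d ** congr_diag (transpose (matrix_inv G)) (\<lambda>i. 1 / d i)
      = transpose G ** (diag_matrix d ** diag_matrix (\<lambda>i. 1 / d i)) ** transpose (matrix_inv G)"
    by (simp add: congr_diag_def matrix_mul_assoc inv_cancel[OF assms(1)])
  also have "\<dots> = mat 1"
    using assms by (simp add: diag_matrix_mult diag_matrix_1 inv_cancel)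
  finally show "congr_diag G d ** congr_diag (transpose (matrix_inv G)) (\<lambda>i. 1 / d i) = mat 1" .
qed

lemma congr_diag_inv_mult:
  assumes "invertible G" "\<And>i. a i \<noteq> 0"
  shows "matrix_inv (congr_diag G a) ** congr_diag G b
    = matrix_inv G ** diag_matrix (\<lambda>i. b i / a i) ** G"
proof -
  have "matrix_inv (congr_diag G a) ** congr_diag G b
     = matrix_inv G ** (diag_matrix (\<lambda>i. 1 / a i) ** diag_matrix b) ** G"
    unfolding matrix_inv_congr_diag[OF assms]
    by (simp add: congr_diag_def matrix_mul_assoc inv_cancel[OF assms(1)])
  then show ?thesis by (simp add: diag_matrix_mult)
qed

text \<open>Multiplying by the inverse of the base point turns each congruence into a similarity by
  \<open>G\<close>, and the trace is invariant under similarity.\<close>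

lemma trace_metric_congr_diag:
  assumes "invertible G" "\<And>i. a i \<noteq> 0"
  shows "trace_metric (congr_diag G a) (congr_diag G b) (congr_diag G c)
    = (\<Sum>i\<in>UNIV. b i * c i / (a i)\<^sup>2)"
proof -
  have "matrix_inv (congr_diag G a) ** congr_diag G b ** (matrix_inv (congr_diag G a) ** congr_diag G c)
     = matrix_inv G ** (diag_matrix (\<lambda>i. b i / a i) ** diag_matrix (\<lambda>i. c i / a i)) ** G"
    unfolding congr_diag_inv_mult[OF assms] by (simp add: matrix_mul_assoc inv_cancel[OF assms(1)])
  also have "trace \<dots> = trace (diag_matrix (\<lambda>i. b i / a i) ** diag_matrix (\<lambda>i. c i / a i))"
    using trace_mul_sym[of _ G] by (metis assms(1) inv_cancel(1) matrix_mul_assoc matrix_mul_lid)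
  finally show ?thesis
    by (simp add: trace_metric_def diag_matrix_mult trace_diag_matrix power2_eq_square flip: matrix_mul_assoc)
qed

section \<open>Positive definite square roots and simultaneous diagonalization\<close>

lemma spd_sqrt_unique:
  fixes y z :: "real ^ 'n::{finite,linorder} ^ 'n::{finite,linorder}"
  assumes y: "y \<in> spd_matrices" and z: "z \<in> spd_matrices" and eq: "y ** y = z ** z"
  shows "y = z"
proof -
  have "y - z \<in> sym_matrices"
    using y z linear_diff[OF bounded_linear.linear[OF bounded_linear_transpose], of y z]
    by (simp add: spd_matrices_def sym_matrices_def)
  then obtain V d where V: "orthogonal_matrix V" and d: "y - z = V ** diag_matrix d ** transpose V"
    using spectral_decomposition by metis
  have "d i = 0" for i
  proof -
    define v where "v = V *v axis i 1"
    have v: "v \<noteq> 0"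
      unfolding v_def invertible_mult_vec_eq_0[OF orthogonal_matrix_inv(2)[OF V]] by simp
    have "(y - z) *v v = V *v (diag_matrix d *v ((transpose V ** V) *v axis i 1))"
      by (simp add: d v_def matrix_vector_mul_assoc matrix_mul_assoc del: transpose_matrix_vector)
    also have "diag_matrix d *v ((transpose V ** V) *v axis i 1) = d i *\<^sub>R axis i 1"
      unfolding V[unfolded orthogonal_matrix] by (simp add: vec_eq_iff diag_matrix_mult_vec axis_def)
    finally have ev: "(y - z) *v v = d i *\<^sub>R v"
      by (simp add: v_def matrix_vector_mult_scaleR)
    \<comment> \<open>Evaluating this splitting on the eigenvector \<open>v\<close> of
      \<open>y - z\<close> gives \<open>d i\<close> times a positive number, so every eigenvalue of
      the difference vanishes.\<close>
    have "y ** y - z ** z = y ** (y - z) + (y - z) ** z"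
      by (simp add: bounded_bilinear.diff_left[OF bounded_bilinear_matrix_mult]
          bounded_bilinear.diff_right[OF bounded_bilinear_matrix_mult])
    then have "0 = v \<bullet> ((y ** (y - z) + (y - z) ** z) *v v)"
      using eq by simp
    also have "\<dots> = v \<bullet> (y *v ((y - z) *v v)) + v \<bullet> ((y - z) *v (z *v v))"
      by (simp add: matrix_vector_mult_add_rdistrib inner_add matrix_vector_mul_assoc)
    also have "v \<bullet> ((y - z) *v (z *v v)) = (z *v v) \<bullet> ((y - z) *v v)"
      using \<open>y - z \<in> sym_matrices\<close> by (rule sym_matrices_inner)
    finally have "0 = d i * (v \<bullet> (y *v v) + v \<bullet> (z *v v))"
      unfolding ev by (simp add: matrix_vector_mult_scaleR algebra_simps inner_commute)
    moreover have "v \<bullet> (y *v v) + v \<bullet> (z *v v) > 0"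
      using y z v by (auto simp: spd_matrices_def intro: add_pos_pos)
    ultimately show ?thesis by simp
  qed
  then have "diag_matrix d = 0" by (simp add: diag_matrix_def vec_eq_iff)
  with d show ?thesis by simp
qed

lemma spd_sqrt:
  fixes x :: "real ^ 'n::{finite,linorder} ^ 'n::{finite,linorder}"
  assumes x: "x \<in> spd_matrices"
  shows "spd_sqrt x \<in> spd_matrices" "spd_sqrt x ** spd_sqrt x = x"
proof -
  obtain V d where V: "orthogonal_matrix V" and d: "x = V ** diag_matrix d ** transpose V"
    using spectral_decomposition spd_matrices_sym[OF x] by metis
  have xd: "x = congr_diag (transpose V) d" by (simp add: d congr_diag_def)
  note i = orthogonal_matrix_inv[OF V]
  have it: "invertible (transpose V)" using i(2) by (rule transpose_invertible)
  have "d i > 0" for i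
  proof -
    \<comment> \<open>The eigenvalue is the value of the quadratic form on the corresponding column
      of \<open>V\<close>.\<close>
    have "(V *v axis i 1) \<bullet> (x *v (V *v axis i 1)) > 0"
      using x invertible_mult_vec_eq_0[OF i(2)] by (auto simp: spd_matrices_def)
    also have "(V *v axis i 1) \<bullet> (x *v (V *v axis i 1)) = (\<Sum>j\<in>UNIV. d j * (((transpose V ** V) *v axis i 1) $ j)\<^sup>2)"
      unfolding xd quadratic_form_congr_diag by (simp add: matrix_vector_mul_assoc del: transpose_matrix_vector)
    also have "\<dots> = (\<Sum>j\<in>UNIV. if j = i then d j else 0)"
      using V by (intro sum.cong) (auto simp: orthogonal_matrix_def axis_def)
    finally show ?thesis by simp
  qed
  then have dpos: "\<And>i. d i > 0" .
  define y where "y = congr_diag (transpose V) (\<lambda>i. sqrt (d i))"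
  have y: "y \<in> spd_matrices" unfolding y_def by (rule congr_diag_spd[OF it]) (simp add: dpos)
  have "y ** y = V ** diag_matrix (\<lambda>i. sqrt (d i)) ** (transpose V ** V) ** diag_matrix (\<lambda>i. sqrt (d i)) ** transpose V"
    by (simp add: y_def congr_diag_def matrix_mul_assoc)
  also have "\<dots> = V ** (diag_matrix (\<lambda>i. sqrt (d i)) ** diag_matrix (\<lambda>i. sqrt (d i))) ** transpose V"
    using V by (simp add: orthogonal_matrix_def matrix_mul_assoc)
  also have "\<dots> = x" using dpos by (simp add: diag_matrix_mult d less_imp_le)
  finally have "\<exists>!y. y \<in> spd_matrices \<and> y ** y = x"
    using y spd_sqrt_unique by metis
  from theI'[OF this] show "spd_sqrt x \<in> spd_matrices" "spd_sqrt x ** spd_sqrt x = x"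
    unfolding spd_sqrt_def by auto
qed

lemma spd_sqrt_invertible_sym:
  fixes x :: "real ^ 'n::{finite,linorder} ^ 'n::{finite,linorder}"
  assumes x: "x \<in> spd_matrices"
  shows "invertible (spd_sqrt x)" "transpose (spd_sqrt x) = spd_sqrt x"
    "transpose (matrix_inv (spd_sqrt x)) = matrix_inv (spd_sqrt x)"
proof -
  show i: "invertible (spd_sqrt x)" and t: "transpose (spd_sqrt x) = spd_sqrt x"
    using spd_sqrt[OF x] invertible_spd by (auto simp: spd_matrices_def sym_matrices_def)
  show "transpose (matrix_inv (spd_sqrt x)) = matrix_inv (spd_sqrt x)"
    using matrix_inv_transpose[OF i] t by simp
qed

text \<open>With \<open>s\<close> the square root of \<open>x\<close>, an eigendecomposition
  \<open>V\<close>, \<open>d\<close> of \<open>matrix_inv s ** u ** matrix_inv s\<close> yields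
  \<open>G = transpose V ** s\<close>.\<close>

lemma simultaneous_diagonalization:
  fixes x u :: "real ^ 'n::{finite,linorder} ^ 'n::{finite,linorder}"
  assumes x: "x \<in> spd_matrices" and u: "u \<in> sym_matrices"
  obtains G d where "invertible G" "antimono d" "x = transpose G ** G" "u = congr_diag G d"
proof -
  define s where "s = spd_sqrt x"
  note s = spd_sqrt[OF x, folded s_def] spd_sqrt_invertible_sym[OF x, folded s_def]
  have "matrix_inv s ** u ** matrix_inv s \<in> sym_matrices"
    using u s by (simp add: sym_matrices_def matrix_transpose_mul matrix_mul_assoc)
  then obtain V d where V: "orthogonal_matrix V" "antimono d"
    and d: "matrix_inv s ** u ** matrix_inv s = V ** diag_matrix d ** transpose V"
    using spectral_decomposition by metis
  have "u = s ** (matrix_inv s ** u ** matrix_inv s) ** s"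
    by (simp add: matrix_mul_assoc inv_cancel[OF s(3)])
  also have "\<dots> = congr_diag (transpose V ** s) d"
    unfolding d by (simp add: congr_diag_def matrix_transpose_mul matrix_mul_assoc s)
  finally have "u = congr_diag (transpose V ** s) d" .
  moreover have "s ** (V ** transpose V) ** s = x"
    using V s by (simp add: orthogonal_matrix_def)
  then have "x = transpose (transpose V ** s) ** (transpose V ** s)"
    by (simp add: matrix_transpose_mul matrix_mul_assoc s)
  moreover have "invertible (transpose V ** s)"
    by (intro invertible_mult transpose_invertible s orthogonal_matrix_inv(2) V)
  ultimately show ?thesis using V(2) that by blast
qed

section \<open>Geodesic rays\<close>

lemma metric_deriv_eq:
  fixes x u v w :: "real ^ 'n ^ 'n"
  assumes "invertible x"
  shows "metric_deriv x u v w =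
    - trace (matrix_inv x ** u ** matrix_inv x ** v ** matrix_inv x ** w)
    - trace (matrix_inv x ** v ** matrix_inv x ** u ** matrix_inv x ** w)"
proof -
  let ?i = "matrix_inv x"
  have "((\<lambda>s. x + s *\<^sub>R u) has_vector_derivative u) (at 0)"
    by (auto intro!: derivative_eq_intros)
  from has_vector_derivative_matrix_inv[OF this]
  have inv: "((\<lambda>s. matrix_inv (x + s *\<^sub>R u)) has_vector_derivative - (?i ** u ** ?i)) (at 0)"
    using assms by simp
  have c: "((\<lambda>s. A) has_vector_derivative 0) (at 0)" for A :: "real ^ 'n ^ 'n"
    by (rule has_vector_derivative_const)
  \<comment> \<open>The product rule inside the trace: each of the two inverses contributes one
    term, carrying \<open>- (?i ** u ** ?i)\<close> in its place.\<close>
  note bounded_linear.has_vector_derivative[OF bounded_linear_trace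
      has_vector_derivative_matrix_mult[OF has_vector_derivative_matrix_mult[OF
      has_vector_derivative_matrix_mult[OF inv c[of v]] inv] c[of w]]]
  then have "((\<lambda>s. trace_metric (x + s *\<^sub>R u) v w) has_real_derivative
    - trace (?i ** v ** ?i ** u ** ?i ** w) - trace (?i ** u ** ?i ** v ** ?i ** w)) (at 0)"
    by (simp add: has_real_derivative_iff_has_vector_derivative trace_metric_def
        matrix_mult_simps matrix_mul_assoc trace_add trace_minus trace_sub)
  from DERIV_imp_deriv[OF this] show ?thesis by (simp add: metric_deriv_def)
qed

lemma trace_metric_nondegenerate:
  fixes x c :: "real ^ 'n::{finite,linorder} ^ 'n::{finite,linorder}"
  assumes "x \<in> spd_matrices" "c \<in> sym_matrices" "trace_metric x c c = 0"
  shows "c = 0"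
proof -
  obtain G d where G: "invertible G" "x = transpose G ** G" "c = congr_diag G d"
    using simultaneous_diagonalization[OF assms(1,2)] by metis
  have "(\<Sum>i\<in>UNIV. d i * d i) = 0"
    using assms(3) trace_metric_congr_diag[OF G(1), of "\<lambda>_. 1" d d]
    by (simp add: G(2,3) congr_diag_1)
  then have "d i = 0" for i
    by (simp add: sum_nonneg_eq_0_iff)
  then have "diag_matrix d = 0" by (simp add: diag_matrix_def vec_eq_iff)
  then show ?thesis by (simp add: G(3) congr_diag_def matrix_mult_simps)
qed

text \<open>By cyclicity of the trace, all three derivatives in the Koszul formula equal
  \<open>-2\<close> times the same trace. Nondegeneracy of the metric, applied to the difference of
  two candidates, makes the description unique. Equal arguments are what the geodesic equation
  contains.\<close>

lemma christoffel_diag: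
  fixes x u :: "real ^ 'n::{finite,linorder} ^ 'n::{finite,linorder}"
  assumes x: "x \<in> spd_matrices" and u: "u \<in> sym_matrices"
  shows "christoffel x u u = - (u ** matrix_inv x ** u)"
proof -
  let ?i = "matrix_inv x"
  note ix = invertible_spd[OF x]
  have si: "transpose ?i = ?i"
    using matrix_inv_transpose[OF ix] x by (simp add: spd_matrices_def sym_matrices_def)
  define c where "c = - (u ** ?i ** u)"
  have c_sym: "c \<in> sym_matrices"
    using u si by (simp add: c_def sym_matrices_def transpose_minus matrix_transpose_mul matrix_mul_assoc)
  have koszul: "2 * trace_metric x c w =
      metric_deriv x u u w + metric_deriv x u u w - metric_deriv x w u u" for w
  proof -
    have "trace (?i ** w ** ?i ** u ** ?i ** u) = trace (?i ** u ** ?i ** u ** ?i ** w)"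
      using trace_mul_sym[of "?i ** w" "?i ** u ** ?i ** u"] by (simp add: matrix_mul_assoc)
    moreover have "trace (?i ** u ** ?i ** w ** ?i ** u) = trace (?i ** u ** ?i ** u ** ?i ** w)"
      using trace_mul_sym[of "?i ** u ** ?i ** w" "?i ** u"] by (simp add: matrix_mul_assoc)
    moreover have "trace_metric x c w = - trace (?i ** u ** ?i ** u ** ?i ** w)"
      by (simp add: trace_metric_def c_def matrix_mult_simps trace_minus matrix_mul_assoc)
    ultimately show ?thesis
      by (simp add: metric_deriv_eq[OF ix])
  qed
  show ?thesis
    unfolding christoffel_def c_def[symmetric]
  proof (rule the_equality)
    show "c \<in> sym_matrices \<and> (\<forall>w\<in>sym_matrices. 2 * trace_metric x c w =
      metric_deriv x u u w + metric_deriv x u u w - metric_deriv x w u u)"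
      using c_sym koszul by blast
    fix b assume b: "b \<in> sym_matrices \<and> (\<forall>w\<in>sym_matrices. 2 * trace_metric x b w =
      metric_deriv x u u w + metric_deriv x u u w - metric_deriv x w u u)"
    then have bc: "b - c \<in> sym_matrices"
      using c_sym by (simp add: sym_matrices_def transpose_diff)
    then have "trace_metric x b (b - c) = trace_metric x c (b - c)"
      using b koszul[of "b - c"] by force
    moreover have "trace_metric x (b - c) w = trace_metric x b w - trace_metric x c w" for w
      by (simp add: trace_metric_def matrix_mult_simps trace_sub)
    ultimately have "trace_metric x (b - c) (b - c) = 0" by simp
    then show "b = c"
      using trace_metric_nondegenerate[OF x bc] by simp
  qed
qed

section \<open>Explicit geodesics and the initial value problem\<close>

lemma has_vector_derivative_congr_diag:
  assumes "\<And>i. ((\<lambda>t. f t i) has_real_derivative f' i) (at t within S)"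
  shows "((\<lambda>t. congr_diag G (f t)) has_vector_derivative congr_diag G f') (at t within S)"
proof -
  have "((\<lambda>s. (diag_matrix (f s) - diag_matrix (f t)) /\<^sub>R (s - t)) \<longlongrightarrow> diag_matrix f') (at t within S)"
  proof (intro vec_tendstoI)
    fix i j
    show "((\<lambda>s. ((diag_matrix (f s) - diag_matrix (f t)) /\<^sub>R (s - t)) $ i $ j) \<longlongrightarrow>
        diag_matrix f' $ i $ j) (at t within S)"
      using assms[of i] unfolding has_field_derivative_iff
      by (cases "i = j") (auto simp: diag_matrix_def divide_inverse_commute)
  qed
  then have "((\<lambda>t. diag_matrix (f t)) has_vector_derivative diag_matrix f') (at t within S)"
    by (simp add: has_vector_derivative_iff_tendsto)
  from has_vector_derivative_matrix_mult[OF has_vector_derivative_matrix_mult[OF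
        has_vector_derivative_const this] has_vector_derivative_const]
  show ?thesis by (simp add: congr_diag_def matrix_mult_simps)
qed

lemma congr_diag_triple:
  assumes "invertible G" "\<And>i. a i \<noteq> 0"
  shows "congr_diag G b ** matrix_inv (congr_diag G a) ** congr_diag G c
    = congr_diag G (\<lambda>i. b i * c i / a i)"
proof -
  have "congr_diag G b ** (matrix_inv (congr_diag G a) ** congr_diag G c)
      = transpose G ** (diag_matrix b ** diag_matrix (\<lambda>i. c i / a i)) ** G"
    unfolding congr_diag_inv_mult[OF assms]
    by (simp add: congr_diag_def matrix_mul_assoc inv_cancel[OF assms(1)])
  then show ?thesis by (simp add: congr_diag_def diag_matrix_mult matrix_mul_assoc)
qed

lemma has_vector_derivative_congr_diag_exp:
  "((\<lambda>t. congr_diag G (\<lambda>i. exp (t * d i))) has_vector_derivative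
    congr_diag G (\<lambda>i. d i * exp (t * d i))) (at t within S)"
  by (rule has_vector_derivative_congr_diag) (auto intro!: derivative_eq_intros)

lemma trace_metric_congr_diag_exp:
  assumes "invertible G"
  shows "trace_metric (congr_diag G (\<lambda>i. exp (t * d i))) (congr_diag G (\<lambda>i. d i * exp (t * d i)))
    (congr_diag G (\<lambda>i. d i * exp (t * d i))) = (\<Sum>i\<in>UNIV. (d i)\<^sup>2)"
  by (subst trace_metric_congr_diag[OF assms]) (simp_all add: power2_eq_square mult_ac)

text \<open>The restriction leaves \<open>undefined\<close> at negative times, in line with the
  extensional function space in \<open>geodesic_rays\<close>, so that equality of rays is equality
  of functions.\<close>

definition diag_ray :: "real ^ 'n ^ 'n \<Rightarrow> ('n \<Rightarrow> real) \<Rightarrow> real \<Rightarrow> real ^ 'n ^ 'n" where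
  "diag_ray G d = (\<lambda>t\<in>{0..}. congr_diag G (\<lambda>i. exp (t * d i)))"

lemma diag_ray_derivative:
  assumes "t \<ge> 0"
  shows "(diag_ray G d has_vector_derivative congr_diag G (\<lambda>i. d i * exp (t * d i))) (at t within {0..})"
  by (rule has_vector_derivative_transform[OF _ _ has_vector_derivative_congr_diag_exp])
    (use assms in \<open>auto simp: diag_ray_def\<close>)

text \<open>In the normal form the geodesic equation is a scalar identity for each index: the
  squared derivative of an exponential, divided by the exponential, is its second
  derivative.\<close>

lemma diag_ray_geodesic:
  fixes G :: "real ^ 'n::{finite,linorder} ^ 'n::{finite,linorder}"
  assumes G: "invertible G" and d: "(\<Sum>i\<in>UNIV. (d i)\<^sup>2) = 1"
  shows "diag_ray G d \<in> geodesic_rays"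
proof -
  define \<gamma>1 where "\<gamma>1 t = congr_diag G (\<lambda>i. d i * exp (t * d i))" for t
  define \<gamma>2 where "\<gamma>2 t = congr_diag G (\<lambda>i. d i * (d i * exp (t * d i)))" for t
  have pos: "congr_diag G (\<lambda>i. exp (t * d i)) \<in> spd_matrices" for t
    by (rule congr_diag_spd[OF G]) simp
  have "(diag_ray G d has_vector_derivative \<gamma>1 t) (at t within {0..}) \<and>
     (\<gamma>1 has_vector_derivative \<gamma>2 t) (at t within {0..}) \<and>
     \<gamma>2 t + christoffel (diag_ray G d t) (\<gamma>1 t) (\<gamma>1 t) = 0 \<and>
     \<gamma>1 t \<in> unit_tangent (diag_ray G d t)" if "t \<ge> 0" for t
  proof (intro conjI)
    show "(diag_ray G d has_vector_derivative \<gamma>1 t) (at t within {0..})"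
      unfolding \<gamma>1_def by (rule diag_ray_derivative[OF that])
    show "(\<gamma>1 has_vector_derivative \<gamma>2 t) (at t within {0..})"
      unfolding \<gamma>1_def \<gamma>2_def
      by (rule has_vector_derivative_congr_diag) (auto intro!: derivative_eq_intros)
    have sym: "\<gamma>1 t \<in> sym_matrices" by (simp add: \<gamma>1_def congr_diag_sym)
    show "\<gamma>2 t + christoffel (diag_ray G d t) (\<gamma>1 t) (\<gamma>1 t) = 0"
      using that christoffel_diag[OF pos sym, of t]
      by (simp add: diag_ray_def \<gamma>1_def \<gamma>2_def congr_diag_triple[OF G] mult_ac)
    show "\<gamma>1 t \<in> unit_tangent (diag_ray G d t)"
      using that sym d
      by (simp add: unit_tangent_def diag_ray_def \<gamma>1_def trace_metric_congr_diag_exp[OF G])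
  qed
  moreover have "diag_ray G d \<in> {0..} \<rightarrow>\<^sub>E spd_matrices"
    using pos by (auto simp: diag_ray_def)
  ultimately show ?thesis
    unfolding geodesic_rays_def by blast
qed

text \<open>The geodesic equation says that \<open>\<gamma>\<^sup>-\<^sup>1 \<gamma>'\<close> is constant, which
  leaves a linear equation with constant coefficients.\<close>

lemma geodesic_ray_eq_diag_ray:
  fixes G :: "real ^ 'n::{finite,linorder} ^ 'n::{finite,linorder}"
  assumes \<gamma>: "\<gamma> \<in> geodesic_rays" and G: "invertible G" and start: "\<gamma> 0 = transpose G ** G"
    and velocity: "(\<gamma> has_vector_derivative congr_diag G d) (at 0 within {0..})"
  shows "\<gamma> = diag_ray G d" "(\<Sum>i\<in>UNIV. (d i)\<^sup>2) = 1"
proof -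
  obtain \<gamma>1 \<gamma>2 where \<gamma>E: "\<gamma> \<in> {0..} \<rightarrow>\<^sub>E spd_matrices"
    and d1: "\<And>t. t \<ge> 0 \<Longrightarrow> (\<gamma> has_vector_derivative \<gamma>1 t) (at t within {0..})"
    and d2: "\<And>t. t \<ge> 0 \<Longrightarrow> (\<gamma>1 has_vector_derivative \<gamma>2 t) (at t within {0..})"
    and geo: "\<And>t. t \<ge> 0 \<Longrightarrow> \<gamma>2 t + christoffel (\<gamma> t) (\<gamma>1 t) (\<gamma>1 t) = 0"
    and unit: "\<And>t. t \<ge> 0 \<Longrightarrow> \<gamma>1 t \<in> unit_tangent (\<gamma> t)"
    using \<gamma> unfolding geodesic_rays_def by auto
  have spd: "\<gamma> t \<in> spd_matrices" if "t \<ge> 0" for t using \<gamma>E that by auto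
  have start1: "\<gamma> 0 = congr_diag G (\<lambda>_. 1)" by (simp add: start congr_diag_1)
  \<comment> \<open>Nontriviality of the one-sided filter makes the derivative at the endpoint
    unique, which identifies \<open>\<gamma>1 0\<close> with the prescribed velocity.\<close>
  have "at (0::real) within {0..} \<noteq> bot"
    by (simp add: at_within_Ici_at_right)
  then have v0: "\<gamma>1 0 = congr_diag G d"
    using vector_derivative_unique_within[OF _ d1[of 0] velocity] by simp
  show "(\<Sum>i\<in>UNIV. (d i)\<^sup>2) = 1"
    using unit[of 0] v0 trace_metric_congr_diag[OF G, of "\<lambda>_. 1" d d]
    by (simp add: unit_tangent_def start1 power2_eq_square)
  \<comment> \<open>By the formula for the Christoffel map, \<open>\<gamma>2 t\<close> is
    \<open>\<gamma>1 t ** matrix_inv (\<gamma> t) ** \<gamma>1 t\<close>, which cancels the term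
    from differentiating the inverse.\<close>
  define P where "P t = matrix_inv (\<gamma> t) ** \<gamma>1 t" for t
  have "(P has_vector_derivative 0) (at t within {0..})" if t: "t \<ge> 0" for t
  proof -
    have s: "\<gamma>1 t \<in> sym_matrices" using unit[OF t] by (simp add: unit_tangent_def)
    have "\<gamma>2 t = \<gamma>1 t ** matrix_inv (\<gamma> t) ** \<gamma>1 t"
      using geo[OF t] christoffel_diag[OF spd[OF t] s] by simp
    then show ?thesis
      unfolding P_def
      using has_vector_derivative_matrix_mult[OF
          has_vector_derivative_matrix_inv[OF d1[OF t] invertible_spd[OF spd[OF t]]] d2[OF t]]
      by (simp add: matrix_mult_simps matrix_mul_assoc)
  qed
  then obtain A where A: "\<And>t. t \<ge> 0 \<Longrightarrow> P t = A"
    using has_vector_derivative_zero_constant[of "{0..}" P] by auto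
  have "A = matrix_inv G ** diag_matrix d ** G"
    using A[of 0] congr_diag_inv_mult[OF G, of "\<lambda>_. 1" d]
    by (simp add: P_def start1 v0)
  moreover have "\<gamma>1 t = \<gamma> t ** P t" if "t \<ge> 0" for t
    using inv_cancel(1)[OF invertible_spd[OF spd[OF that]]] by (simp add: P_def matrix_mul_assoc)
  ultimately have \<gamma>1: "\<gamma>1 t = \<gamma> t ** matrix_inv G ** diag_matrix d ** G" if "t \<ge> 0" for t
    using A that by (simp add: matrix_mul_assoc)
  \<comment> \<open>An integrating factor for the linear equation: \<open>H t\<close> is the inverse
    of \<open>G\<close> times the diagonal matrix with entries \<open>exp (- t * d i)\<close>. The
    product \<open>\<gamma> t ** H t\<close> keeps its initial value
    \<open>transpose G\<close>.\<close>
  define H where "H t = matrix_inv G ** congr_diag (mat 1) (\<lambda>i. exp (t * - d i))" for t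
  have "((\<lambda>t. \<gamma> t ** H t) has_vector_derivative 0) (at t within {0..})" if t: "t \<ge> 0" for t
  proof -
    have "(H has_vector_derivative matrix_inv G ** congr_diag (mat 1) (\<lambda>i. - d i * exp (t * - d i)))
        (at t within {0..})"
      unfolding H_def using has_vector_derivative_matrix_mult[OF has_vector_derivative_const
          has_vector_derivative_congr_diag_exp[of "mat 1" "\<lambda>i. - d i"]]
      by (simp add: matrix_mult_simps)
    from has_vector_derivative_matrix_mult[OF d1[OF t] this]
    have "((\<lambda>t. \<gamma> t ** H t) has_vector_derivative
      \<gamma> t ** (matrix_inv G ** diag_matrix (\<lambda>i. - d i * exp (t * - d i))) +
      \<gamma> t ** matrix_inv G ** (diag_matrix d ** diag_matrix (\<lambda>i. exp (t * - d i)))) (at t within {0..})"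
      unfolding \<gamma>1[OF t] H_def by (simp add: congr_diag_def matrix_mul_assoc inv_cancel[OF G])
    moreover have "diag_matrix (\<lambda>i. - d i * exp (t * - d i)) = - (diag_matrix d ** diag_matrix (\<lambda>i. exp (t * - d i)))"
      unfolding diag_matrix_mult by (simp add: diag_matrix_def vec_eq_iff)
    ultimately show ?thesis by (simp add: matrix_mult_simps matrix_mul_assoc)
  qed
  then obtain B where B: "\<And>t. t \<ge> 0 \<Longrightarrow> \<gamma> t ** H t = B"
    using has_vector_derivative_zero_constant[of "{0..}" "\<lambda>t. \<gamma> t ** H t"] by auto
  have "B = transpose G"
    using B[of 0] by (simp add: H_def congr_diag_1 start matrix_mul_assoc inv_cancel[OF G])
  have "\<gamma> t = congr_diag G (\<lambda>i. exp (t * d i))" if "t \<ge> 0" for t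
  proof -
    have "\<gamma> t ** H t ** diag_matrix (\<lambda>i. exp (t * d i)) ** G
      = \<gamma> t ** matrix_inv G ** (diag_matrix (\<lambda>i. exp (t * - d i)) ** diag_matrix (\<lambda>i. exp (t * d i))) ** G"
      by (simp add: H_def congr_diag_def matrix_mul_assoc)
    also have "\<dots> = \<gamma> t"
      by (simp add: diag_matrix_mult diag_matrix_1 inv_cancel[OF G] flip: exp_add)
    finally show ?thesis
      using B[OF that] \<open>B = transpose G\<close> by (simp add: congr_diag_def)
  qed
  then show "\<gamma> = diag_ray G d"
    using PiE_arb[OF \<gamma>E] by (intro ext) (simp add: diag_ray_def)
qed

lemma geodesic_ray_diag:
  fixes \<gamma> :: "real \<Rightarrow> real ^ 'n::{finite,linorder} ^ 'n::{finite,linorder}"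
  assumes \<gamma>: "\<gamma> \<in> geodesic_rays"
  obtains G d where "invertible G" "antimono d" "(\<Sum>i\<in>UNIV. (d i)\<^sup>2) = 1"
    "\<gamma> = diag_ray G d"
proof -
  obtain \<gamma>' where E: "\<gamma> \<in> {0..} \<rightarrow>\<^sub>E spd_matrices"
    and "\<forall>t\<ge>0. (\<gamma> has_vector_derivative \<gamma>' t) (at t within {0..}) \<and> \<gamma>' t \<in> unit_tangent (\<gamma> t)"
    using \<gamma> unfolding geodesic_rays_def by blast
  then have \<gamma>': "\<gamma> 0 \<in> spd_matrices" "\<gamma>' 0 \<in> sym_matrices"
    "(\<gamma> has_vector_derivative \<gamma>' 0) (at 0 within {0..})"
    using PiE_mem[OF E, of 0] by (auto simp: unit_tangent_def)
  obtain G d where "invertible G" "antimono d" "\<gamma> 0 = transpose G ** G" "\<gamma>' 0 = congr_diag G d"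
    using simultaneous_diagonalization[OF \<gamma>'(1,2)] .
  with geodesic_ray_eq_diag_ray[OF \<gamma>] \<gamma>'(3) that show ?thesis by metis
qed

section \<open>Comparison of the distance with quadratic forms\<close>

lemma bounded_linear_quadratic_form:
  "bounded_linear (\<lambda>A :: real ^ 'n ^ 'n. v \<bullet> (A *v v))"
  by (intro linear_conv_bounded_linear[THEN iffD1] linearI)
    (simp_all add: matrix_vector_mult_add_rdistrib inner_add flip: scaleR_matrix_vector_assoc)

text \<open>In the normal form each \<open>\<bar>d i\<bar>\<close> is at most the Euclidean norm of
  \<open>d\<close>, which is the length of \<open>u\<close>. This is the infinitesimal version of
  the Lipschitz bound for logarithms of quadratic forms.\<close>

lemma abs_quadratic_form_le:
  fixes x u :: "real ^ 'n::{finite,linorder} ^ 'n::{finite,linorder}"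
  assumes "x \<in> spd_matrices" "u \<in> sym_matrices"
  shows "\<bar>v \<bullet> (u *v v)\<bar> \<le> sqrt (trace_metric x u u) * (v \<bullet> (x *v v))"
proof -
  obtain G d where G: "invertible G" "x = transpose G ** G" "u = congr_diag G d"
    using simultaneous_diagonalization[OF assms] by metis
  have x: "x = congr_diag G (\<lambda>_. 1)" by (simp add: G(2) congr_diag_1)
  have tr: "trace_metric x u u = (\<Sum>i\<in>UNIV. (d i)\<^sup>2)"
    unfolding x G(3) by (subst trace_metric_congr_diag[OF G(1)]) (simp_all add: power2_eq_square)
  have d: "\<bar>d i\<bar> \<le> sqrt (trace_metric x u u)" for i
    unfolding tr by (intro real_le_rsqrt) (auto intro: member_le_sum)
  have "\<bar>v \<bullet> (u *v v)\<bar> \<le> (\<Sum>i\<in>UNIV. \<bar>d i * ((G *v v) $ i)\<^sup>2\<bar>)"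
    unfolding G(3) quadratic_form_congr_diag by (rule sum_abs)
  also have "\<dots> \<le> (\<Sum>i\<in>UNIV. sqrt (trace_metric x u u) * ((G *v v) $ i)\<^sup>2)"
    using d by (intro sum_mono) (simp add: abs_mult mult_right_mono)
  also have "\<dots> = sqrt (trace_metric x u u) * (v \<bullet> (x *v v))"
    unfolding x quadratic_form_congr_diag by (simp add: sum_distrib_left)
  finally show ?thesis .
qed

text \<open>The derivative of \<open>ln (v \<bullet> (g t *v v))\<close> is bounded by the speed of
  \<open>g\<close>; integration gives the claim.\<close>

lemma ln_quadratic_form_le_length:
  fixes x y :: "real ^ 'n::{finite,linorder} ^ 'n::{finite,linorder}"
  assumes g: "g \<in> spd_curves x y" and v: "v \<noteq> 0"
  shows "\<bar>ln (v \<bullet> (y *v v)) - ln (v \<bullet> (x *v v))\<bar> \<le> integral {0..1} (speed g)"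
proof -
  obtain S where S: "finite S" "continuous_on {0..1} g" "g C1_differentiable_on ({0..1} - S)"
    and spd: "\<And>t. t \<in> {0..1} \<Longrightarrow> g t \<in> spd_matrices" and ends: "g 0 = x" "g 1 = y"
    and int: "speed g integrable_on {0..1}"
    using g unfolding spd_curves_def valid_path_def piecewise_C1_differentiable_on_def
      path_image_def pathstart_def pathfinish_def image_subset_iff by blast
  define D where "D t = vector_derivative g (at t)" for t
  define f where "f t = ln (v \<bullet> (g t *v v))" for t
  define f' where "f' t = (v \<bullet> (D t *v v)) / (v \<bullet> (g t *v v))" for t
  have pos: "v \<bullet> (g t *v v) > 0" if "t \<in> {0..1}" for t
    using spd[OF that] v by (simp add: spd_matrices_def)
  have D: "(g has_vector_derivative D t) (at t)" if "t \<in> {0<..<1} - S" for t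
    using S(3) that unfolding D_def C1_differentiable_on_eq vector_derivative_works[symmetric] by auto
  \<comment> \<open>Transposition fixes the curve on an open interval, hence also its
    velocity.\<close>
  have D_sym: "D t \<in> sym_matrices" if t: "t \<in> {0<..<1} - S" for t
  proof -
    have "((\<lambda>s. transpose (g s)) has_vector_derivative transpose (D t)) (at t)"
      by (rule bounded_linear.has_vector_derivative[OF bounded_linear_transpose D[OF t]])
    moreover have "transpose (g s) = g s" if "s \<in> {0<..<1}" for s
      using spd[of s] that by (simp add: spd_matrices_def sym_matrices_def)
    ultimately have "(g has_vector_derivative transpose (D t)) (at t)"
      using has_vector_derivative_transform_within_open[of "\<lambda>s. transpose (g s)" _ t "{0<..<1}" g] t
      by simp
    then show ?thesis
      using vector_derivative_unique_at D[OF t] by (auto simp: sym_matrices_def)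
  qed
  have f': "(f' has_integral (f 1 - f 0)) {0..1}"
  proof (rule fundamental_theorem_of_calculus_interior_strong[OF S(1)])
    fix t assume t: "t \<in> {0<..<1} - S"
    have "((\<lambda>t. v \<bullet> (g t *v v)) has_real_derivative v \<bullet> (D t *v v)) (at t)"
      unfolding has_real_derivative_iff_has_vector_derivative
      by (rule bounded_linear.has_vector_derivative[OF bounded_linear_quadratic_form D[OF t]])
    from DERIV_ln_divide[THEN DERIV_chain2, OF _ this] show "(f has_vector_derivative f' t) (at t)"
      unfolding has_real_derivative_iff_has_vector_derivative[symmetric] f_def f'_def
      using pos[of t] t by simp
  next
    have "continuous_on {0..1} (\<lambda>t. v \<bullet> (g t *v v))"
      by (rule bounded_linear.continuous_on[OF bounded_linear_quadratic_form S(2)])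
    then show "continuous_on {0..1} f"
      unfolding f_def by (rule continuous_on_ln) (use pos in force)
  qed simp
  \<comment> \<open>The pointwise estimate is available only at interior smooth points. Both
    integrands are set to 0 at the finitely many other points, which leaves the integrals
    unchanged.\<close>
  define T where "T = insert 0 (insert 1 S)"
  define h where "h t = (if t \<in> T then 0 else f' t)" for t
  define k where "k t = (if t \<in> T then 0 else speed g t)" for t
  have "finite T" using S(1) by (simp add: T_def)
  then have h: "(h has_integral (f 1 - f 0)) {0..1}"
    and k: "(k has_integral integral {0..1} (speed g)) {0..1}"
    using has_integral_spike_finite[OF _ _ f', of T h]
      has_integral_spike_finite[OF _ _ integrable_integral[OF int], of T k]
    by (simp_all add: h_def k_def)
  have "norm (h t) \<le> k t" if t: "t \<in> {0..1}" for t
  proof (cases "t \<in> T")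
    case False
    then have "t \<in> {0<..<1} - S" using t by (auto simp: T_def)
    then show ?thesis
      using abs_quadratic_form_le[OF spd[OF t], of "D t" v] D_sym pos[OF t] False
      by (simp add: h_def k_def f'_def speed_def divide_le_eq flip: D_def)
  qed (simp add: h_def k_def)
  then have "norm (integral {0..1} h) \<le> integral {0..1} k"
    by (intro integral_norm_bound_integral) (use h k in \<open>auto simp: has_integral_integrable\<close>)
  then show ?thesis
    using integral_unique[OF h] integral_unique[OF k] by (simp add: f_def ends)
qed

section \<open>Connecting geodesics and two-sided estimates of the distance\<close>

lemma congr_diag_exp_curve:
  fixes G :: "real ^ 'n ^ 'n" and l :: "'n \<Rightarrow> real"
  assumes G: "invertible G"
  defines "g \<equiv> \<lambda>t. congr_diag G (\<lambda>i. exp (t * l i))"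
  shows "g \<in> spd_curves (transpose G ** G) (congr_diag G (\<lambda>i. exp (l i)))"
    "integral {0..1} (speed g) = sqrt (\<Sum>i\<in>UNIV. (l i)\<^sup>2)"
proof -
  have d: "(g has_vector_derivative congr_diag G (\<lambda>i. l i * exp (t * l i))) (at t)" for t
    unfolding g_def by (rule has_vector_derivative_congr_diag_exp)
  have "((\<lambda>t. congr_diag G (\<lambda>i. l i * exp (t * l i))) has_vector_derivative
      congr_diag G (\<lambda>i. l i * (l i * exp (t * l i)))) (at t)" for t
    by (rule has_vector_derivative_congr_diag) (auto intro!: derivative_eq_intros)
  then have c: "continuous_on {0..1} (\<lambda>t. congr_diag G (\<lambda>i. l i * exp (t * l i)))"
    by (intro continuous_at_imp_continuous_on ballI has_vector_derivative_continuous)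
  have "g C1_differentiable_on {0..1}"
    unfolding C1_differentiable_on_def
    by (rule exI[of _ "\<lambda>t. congr_diag G (\<lambda>i. l i * exp (t * l i))"]) (intro conjI ballI d c)
  then have "valid_path g"
    unfolding valid_path_def by (rule C1_differentiable_imp_piecewise)
  moreover have speed: "speed g = (\<lambda>t. sqrt (\<Sum>i\<in>UNIV. (l i)\<^sup>2))"
    unfolding speed_def vector_derivative_at[OF d] unfolding g_def
    by (simp add: trace_metric_congr_diag_exp[OF G])
  moreover have "g t \<in> spd_matrices" for t
    unfolding g_def by (rule congr_diag_spd[OF G]) simp
  ultimately show "g \<in> spd_curves (transpose G ** G) (congr_diag G (\<lambda>i. exp (l i)))"
    unfolding spd_curves_def path_image_def pathstart_def pathfinish_def
    by (auto simp: g_def congr_diag_1)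
  show "integral {0..1} (speed g) = sqrt (\<Sum>i\<in>UNIV. (l i)\<^sup>2)"
    unfolding speed by simp
qed

text \<open>The last two facts say that the numbers \<open>l i\<close> are read off from the two
  quadratic forms at the columns of \<open>matrix_inv G\<close>, so that comparing the forms bounds
  them.\<close>

lemma spd_simultaneous_diagonalization:
  fixes x y :: "real ^ 'n::{finite,linorder} ^ 'n::{finite,linorder}"
  assumes x: "x \<in> spd_matrices" and y: "y \<in> spd_matrices"
  obtains G l where "invertible G" "x = transpose G ** G" "y = congr_diag G (\<lambda>i. exp (l i))"
    "\<And>i. exp (l i) = (matrix_inv G *v axis i 1) \<bullet> (y *v (matrix_inv G *v axis i 1))"
    "\<And>i. 1 = (matrix_inv G *v axis i 1) \<bullet> (x *v (matrix_inv G *v axis i 1))"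
proof -
  obtain G d where G: "invertible G" "x = transpose G ** G" "y = congr_diag G d"
    using simultaneous_diagonalization[OF x spd_matrices_sym[OF y]] by metis
  have e: "(matrix_inv G *v axis i 1) \<bullet> (congr_diag G c *v (matrix_inv G *v axis i 1)) = c i" for c i
  proof -
    have "(matrix_inv G *v axis i 1) \<bullet> (congr_diag G c *v (matrix_inv G *v axis i 1))
      = (\<Sum>j\<in>UNIV. if j = i then c j else 0)"
      unfolding quadratic_form_congr_diag
      by (intro sum.cong) (auto simp: matrix_vector_mul_assoc inv_cancel[OF G(1)] axis_def)
    then show ?thesis by simp
  qed
  have "d i > 0" for i
  proof -
    have "matrix_inv G *v axis i (1::real) \<noteq> 0"
      using invertible_mult_vec_eq_0[OF invertible_matrix_inv[OF G(1)]] by simp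
    then show ?thesis
      using y e[of i d] by (auto simp: spd_matrices_def G(3))
  qed
  then have "exp (ln (d i)) = d i" for i by simp
  with G e e[of _ "\<lambda>_. 1"] that[of G "\<lambda>i. ln (d i)"] show ?thesis by (simp add: congr_diag_1)
qed

lemma spd_curves_nonempty:
  fixes x y :: "real ^ 'n::{finite,linorder} ^ 'n::{finite,linorder}"
  assumes "x \<in> spd_matrices" "y \<in> spd_matrices"
  shows "spd_curves x y \<noteq> {}"
  by (rule spd_simultaneous_diagonalization[OF assms]) (use congr_diag_exp_curve in blast)

lemma ln_quadratic_form_le_dist:
  fixes x y :: "real ^ 'n::{finite,linorder} ^ 'n::{finite,linorder}"
  assumes "x \<in> spd_matrices" "y \<in> spd_matrices" "v \<noteq> 0"
  shows "\<bar>ln (v \<bullet> (y *v v)) - ln (v \<bullet> (x *v v))\<bar> \<le> spd_dist x y"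
  unfolding spd_dist_def
  by (intro cINF_greatest spd_curves_nonempty assms ln_quadratic_form_le_length)

lemma spd_dist_le_length:
  fixes x y :: "real ^ 'n::{finite,linorder} ^ 'n::{finite,linorder}"
  assumes "g \<in> spd_curves x y"
  shows "spd_dist x y \<le> integral {0..1} (speed g)"
  unfolding spd_dist_def
proof (rule cINF_lower[OF _ assms])
  have "0 \<le> integral {0..1} (speed g)" if "g \<in> spd_curves x y" for g
    \<comment> \<open>Any nonzero vector serves here; the Lipschitz estimate bounds the length below
      by an absolute value.\<close>
    using ln_quadratic_form_le_length[OF that, of "axis (SOME i. True) 1"] by force
  then show "bdd_below ((\<lambda>g. integral {0..1} (speed g)) ` spd_curves x y)"
    by (intro bdd_belowI2)
qed

text \<open>The Loewner order up to a factor: \<open>C\<close> times \<open>y\<close> dominates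
  \<open>x\<close>.\<close>

definition form_le :: "real \<Rightarrow> real ^ 'n ^ 'n \<Rightarrow> real ^ 'n ^ 'n \<Rightarrow> bool" where
  "form_le C x y \<longleftrightarrow> (\<forall>v. v \<bullet> (x *v v) \<le> C * (v \<bullet> (y *v v)))"

lemma form_le_exp_dist:
  fixes x y :: "real ^ 'n::{finite,linorder} ^ 'n::{finite,linorder}"
  assumes x: "x \<in> spd_matrices" and y: "y \<in> spd_matrices" and b: "spd_dist x y \<le> b"
  shows "form_le (exp b) x y" "form_le (exp b) y x"
proof -
  have "v \<bullet> (x *v v) \<le> exp b * (v \<bullet> (y *v v)) \<and> v \<bullet> (y *v v) \<le> exp b * (v \<bullet> (x *v v))" for v
  proof (cases "v = 0")
    case False
    then have pos: "v \<bullet> (x *v v) > 0" "v \<bullet> (y *v v) > 0"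
      using x y by (auto simp: spd_matrices_def)
    have "\<bar>ln (v \<bullet> (y *v v)) - ln (v \<bullet> (x *v v))\<bar> \<le> b"
      using ln_quadratic_form_le_dist[OF x y False] b by linarith
    then have "ln (v \<bullet> (x *v v)) \<le> ln (exp b * (v \<bullet> (y *v v)))"
      "ln (v \<bullet> (y *v v)) \<le> ln (exp b * (v \<bullet> (x *v v)))"
      using pos by (simp_all add: ln_mult_pos)
    then show ?thesis using pos by simp
  qed simp
  then show "form_le (exp b) x y" "form_le (exp b) y x" by (auto simp: form_le_def)
qed

text \<open>Testing both comparisons on the columns of \<open>matrix_inv G\<close> gives
  \<open>\<bar>l i\<bar> \<le> ln C\<close>, and the connecting geodesic has length equal to the
  Euclidean norm of \<open>l\<close>.\<close>

lemma spd_dist_le_of_form_le: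
  fixes x y :: "real ^ 'n::{finite,linorder} ^ 'n::{finite,linorder}"
  assumes x: "x \<in> spd_matrices" and y: "y \<in> spd_matrices"
    and C: "form_le C x y" "form_le C y x"
  shows "spd_dist x y \<le> sqrt (CARD('n) * (ln C)\<^sup>2)"
proof -
  obtain G l where G: "invertible G" "x = transpose G ** G" "y = congr_diag G (\<lambda>i. exp (l i))"
    and e: "\<And>i. exp (l i) = (matrix_inv G *v axis i 1) \<bullet> (y *v (matrix_inv G *v axis i 1))"
      "\<And>i. 1 = (matrix_inv G *v axis i 1) \<bullet> (x *v (matrix_inv G *v axis i 1))"
    by (rule spd_simultaneous_diagonalization[OF x y]) blast
  have "(l i)\<^sup>2 \<le> (ln C)\<^sup>2" for i
  proof -
    have 1: "1 \<le> C * exp (l i)" "exp (l i) \<le> C"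
      using C e(1)[of i] e(2)[of i] unfolding form_le_def by (metis mult.right_neutral)+
    then have "C > 0" using exp_gt_zero[of "l i"] by linarith
    have "0 \<le> ln (C * exp (l i))" using 1(1) by simp
    then have "- l i \<le> ln C" using \<open>C > 0\<close> by (simp add: ln_mult_pos)
    moreover have "l i \<le> ln C" using 1(2) \<open>C > 0\<close> by (simp add: ln_ge_iff)
    ultimately show ?thesis by (intro abs_le_square_iff[THEN iffD1]) linarith
  qed
  then have "(\<Sum>i\<in>UNIV. (l i)\<^sup>2) \<le> CARD('n) * (ln C)\<^sup>2"
    using sum_bounded_above[of UNIV "\<lambda>i. (l i)\<^sup>2" "(ln C)\<^sup>2"] by simp
  then show ?thesis
    using spd_dist_le_length[OF congr_diag_exp_curve(1)[OF G(1), of l]]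
    unfolding congr_diag_exp_curve(2)[OF G(1)] G(2)[symmetric] G(3)[symmetric]
    by (meson order_trans real_sqrt_le_mono)
qed

lemma geodesic_rays_spd: "\<gamma> \<in> geodesic_rays \<Longrightarrow> t \<ge> 0 \<Longrightarrow> \<gamma> t \<in> spd_matrices"
  by (auto simp: geodesic_rays_def)

text \<open>A bound \<open>b\<close> on the distance gives the factor \<open>exp b\<close>; a factor
  \<open>C\<close> gives a distance bound depending only on \<open>C\<close> and the size of the
  matrices. The sign condition lets factors be multiplied in the proof of transitivity.\<close>

lemma asymptotic_iff:
  fixes \<gamma>1 \<gamma>2 :: "real \<Rightarrow> real ^ 'n::{finite,linorder} ^ 'n::{finite,linorder}"
  shows "(\<gamma>1, \<gamma>2) \<in> asymptotic \<longleftrightarrow> \<gamma>1 \<in> geodesic_rays \<and> \<gamma>2 \<in> geodesic_rays \<and>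
    (\<exists>C\<ge>0. \<forall>t\<ge>0. form_le C (\<gamma>1 t) (\<gamma>2 t) \<and> form_le C (\<gamma>2 t) (\<gamma>1 t))"
proof (cases "\<gamma>1 \<in> geodesic_rays \<and> \<gamma>2 \<in> geodesic_rays")
  case True
  then have spd: "\<And>t. t \<ge> 0 \<Longrightarrow> \<gamma>1 t \<in> spd_matrices" "\<And>t. t \<ge> 0 \<Longrightarrow> \<gamma>2 t \<in> spd_matrices"
    by (auto intro: geodesic_rays_spd)
  have "bounded ((\<lambda>t. spd_dist (\<gamma>1 t) (\<gamma>2 t)) ` {0..}) \<longleftrightarrow>
    (\<exists>C\<ge>0. \<forall>t\<ge>0. form_le C (\<gamma>1 t) (\<gamma>2 t) \<and> form_le C (\<gamma>2 t) (\<gamma>1 t))"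
  proof
    assume "bounded ((\<lambda>t. spd_dist (\<gamma>1 t) (\<gamma>2 t)) ` {0..})"
    then obtain b where "\<And>t. t \<ge> 0 \<Longrightarrow> spd_dist (\<gamma>1 t) (\<gamma>2 t) \<le> b"
      by (auto simp: bounded_iff abs_le_iff)
    then show "\<exists>C\<ge>0. \<forall>t\<ge>0. form_le C (\<gamma>1 t) (\<gamma>2 t) \<and> form_le C (\<gamma>2 t) (\<gamma>1 t)"
      using form_le_exp_dist[OF spd] by (intro exI[of _ "exp b"]) auto
  next
    assume "\<exists>C\<ge>0. \<forall>t\<ge>0. form_le C (\<gamma>1 t) (\<gamma>2 t) \<and> form_le C (\<gamma>2 t) (\<gamma>1 t)"
    then obtain C where C: "\<And>t. t \<ge> 0 \<Longrightarrow> form_le C (\<gamma>1 t) (\<gamma>2 t) \<and> form_le C (\<gamma>2 t) (\<gamma>1 t)"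
      by blast
    \<comment> \<open>The Lipschitz bound at one nonzero vector supplies nonnegativity of the
      distance, so an upper bound controls its absolute value.\<close>
    have "norm (spd_dist (\<gamma>1 t) (\<gamma>2 t)) \<le> sqrt (CARD('n) * (ln C)\<^sup>2)" if "t \<ge> 0" for t
      using spd_dist_le_of_form_le[OF spd(1)[OF that] spd(2)[OF that]] C[OF that]
        ln_quadratic_form_le_dist[OF spd(1)[OF that] spd(2)[OF that], of "axis (SOME i. True) 1"]
      by force
    then show "bounded ((\<lambda>t. spd_dist (\<gamma>1 t) (\<gamma>2 t)) ` {0..})"
      by (auto simp: bounded_iff)
  qed
  then show ?thesis using True by (simp add: asymptotic_def)
qed (auto simp: asymptotic_def)

section \<open>Asymptotic rays\<close>

lemma form_le_trans:
  assumes "form_le C x y" "form_le C' y z" "C \<ge> 0"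
  shows "form_le (C * C') x z"
  unfolding form_le_def
proof
  fix v
  have "v \<bullet> (x *v v) \<le> C * (v \<bullet> (y *v v))" using assms(1) by (simp add: form_le_def)
  also have "\<dots> \<le> C * (C' * (v \<bullet> (z *v v)))"
    using assms(2,3) by (intro mult_left_mono) (simp_all add: form_le_def)
  finally show "v \<bullet> (x *v v) \<le> C * C' * (v \<bullet> (z *v v))" by simp
qed

lemma asymptotic_sym: "sym (asymptotic :: ((real \<Rightarrow> real ^ 'n::{finite,linorder} ^ 'n::{finite,linorder}) \<times> _) set)"
  by (rule symI) (auto simp: asymptotic_iff)

lemma asymptotic_trans: "trans (asymptotic :: ((real \<Rightarrow> real ^ 'n::{finite,linorder} ^ 'n::{finite,linorder}) \<times> _) set)"
proof (rule transI)
  fix \<gamma>1 \<gamma>2 \<gamma>3 :: "real \<Rightarrow> real ^ 'n::{finite,linorder} ^ 'n::{finite,linorder}"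
  assume "(\<gamma>1, \<gamma>2) \<in> asymptotic" "(\<gamma>2, \<gamma>3) \<in> asymptotic"
  then obtain C C' where \<gamma>: "\<gamma>1 \<in> geodesic_rays" "\<gamma>3 \<in> geodesic_rays"
    and C: "C \<ge> 0" "\<And>t. t \<ge> 0 \<Longrightarrow> form_le C (\<gamma>1 t) (\<gamma>2 t) \<and> form_le C (\<gamma>2 t) (\<gamma>1 t)"
    and C': "C' \<ge> 0" "\<And>t. t \<ge> 0 \<Longrightarrow> form_le C' (\<gamma>2 t) (\<gamma>3 t) \<and> form_le C' (\<gamma>3 t) (\<gamma>2 t)"
    unfolding asymptotic_iff by blast
  have "form_le (C * C') (\<gamma>1 t) (\<gamma>3 t) \<and> form_le (C * C') (\<gamma>3 t) (\<gamma>1 t)" if "t \<ge> 0" for t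
    using C(2)[OF that] C'(2)[OF that] C(1) C'(1) form_le_trans by (metis mult.commute)
  then show "(\<gamma>1, \<gamma>3) \<in> asymptotic"
    unfolding asymptotic_iff using \<gamma> C(1) C'(1) by (intro conjI exI[of _ "C * C'"]) auto
qed

section \<open>Growth rates and uniqueness of asymptotic rays\<close>

lemma exp_bounded_imp_nonpos:
  fixes a c C :: real
  assumes "\<And>t. t \<ge> 0 \<Longrightarrow> a * exp (t * c) \<le> C" "a > 0"
  shows "c \<le> 0"
proof (rule ccontr)
  assume "\<not> c \<le> 0"
  then have c: "c > 0" by simp
  \<comment> \<open>At this time the linear lower bound \<open>a * (1 + t * c)\<close> equals
    \<open>a + \<bar>C\<bar>\<close>, which exceeds \<open>C\<close>.\<close>
  define t where "t = \<bar>C\<bar> / (a * c)"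
  have "t \<ge> 0" using c assms(2) by (simp add: t_def)
  have "a + \<bar>C\<bar> = a * (1 + t * c)" using c assms(2) by (simp add: t_def field_simps)
  also have "\<dots> \<le> a * exp (t * c)" using assms(2) by (intro mult_left_mono exp_ge_add_one_self) auto
  also have "\<dots> \<le> C" by (rule assms(1)[OF \<open>t \<ge> 0\<close>])
  finally show False using assms(2) by linarith
qed

text \<open>On the \<open>j\<close>-th column of \<open>matrix_inv G\<close> the form of the second
  ray is exactly \<open>exp (t * d j)\<close>, while that of the first is at least a positive
  multiple of \<open>exp (t * e i)\<close>.\<close>

lemma exponent_le:
  fixes G H :: "real ^ 'n ^ 'n"
  assumes G: "invertible G"
    and le: "\<And>t. t \<ge> 0 \<Longrightarrow> form_le C (diag_ray H e t) (diag_ray G d t)"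
    and K: "(H ** matrix_inv G) $ i $ j \<noteq> 0"
  shows "e i \<le> d j"
proof -
  let ?K = "H ** matrix_inv G"
  have "(?K $ i $ j)\<^sup>2 * exp (t * (e i - d j)) \<le> C" if t: "t \<ge> 0" for t
  proof -
    define v where "v = matrix_inv G *v axis j 1"
    have Hv: "(H *v v) $ k = ?K $ k $ j" for k
      unfolding v_def matrix_vector_mul_assoc by (simp add: matrix_vector_mult_basis column_def)
    have Gv: "G *v v = axis j 1"
      by (simp add: v_def matrix_vector_mul_assoc inv_cancel[OF G])
    have "exp (t * e i) * (?K $ i $ j)\<^sup>2 \<le> v \<bullet> (diag_ray H e t *v v)"
      using t by (simp add: diag_ray_def quadratic_form_congr_diag Hv) (intro member_le_sum, auto)
    also have "\<dots> \<le> C * (v \<bullet> (diag_ray G d t *v v))"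
      using le[OF t] by (simp add: form_le_def)
    also have "v \<bullet> (diag_ray G d t *v v) = (\<Sum>k\<in>UNIV. exp (t * d k) * (axis j 1 $ k)\<^sup>2)"
      using t by (simp add: diag_ray_def quadratic_form_congr_diag Gv)
    also have "\<dots> = (\<Sum>k\<in>UNIV. if k = j then exp (t * d k) else 0)"
      by (intro sum.cong) (auto simp: axis_def)
    finally have "exp (t * e i) * (?K $ i $ j)\<^sup>2 \<le> C * exp (t * d j)" by simp
    then show ?thesis by (simp add: right_diff_distrib exp_diff field_simps)
  qed
  from exp_bounded_imp_nonpos[OF this] K show ?thesis by simp
qed

text \<open>The change of basis \<open>H G\<^sup>-\<^sup>1\<close> is orthogonal and, by comparison of growth rates,
  intertwines the two diagonal matrices.\<close>

lemma diag_ray_unique: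
  fixes G H :: "real ^ 'n ^ 'n"
  assumes G: "invertible G" and H: "invertible H" and start: "transpose G ** G = transpose H ** H"
    and le: "\<And>t. t \<ge> 0 \<Longrightarrow> form_le C (diag_ray G d t) (diag_ray H e t)"
      "\<And>t. t \<ge> 0 \<Longrightarrow> form_le C (diag_ray H e t) (diag_ray G d t)"
  shows "diag_ray G d = diag_ray H e"
proof -
  define K where "K = H ** matrix_inv G"
  have HK: "H = K ** G" by (simp add: K_def inv_cancel[OF G])
  have "transpose K ** K = transpose (matrix_inv G) ** (transpose H ** H) ** matrix_inv G"
    by (simp add: K_def matrix_transpose_mul matrix_mul_assoc)
  also have "\<dots> = mat 1"
    unfolding start[symmetric] by (simp add: matrix_mul_assoc inv_cancel[OF G])
  finally have KK: "transpose K ** K = mat 1" .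
  have "G ** matrix_inv H ** K = mat 1"
    by (simp add: K_def matrix_mul_assoc inv_cancel[OF G] inv_cancel[OF H])
  then have "G ** matrix_inv H = transpose K"
    using KK by (metis matrix_left_right_inverse matrix_mul_assoc matrix_mul_lid matrix_mul_rid)
  then have K': "(G ** matrix_inv H) $ j $ i = K $ i $ j" for i j
    by (simp add: transpose_def)
  \<comment> \<open>A nonzero entry of \<open>K\<close> is also a nonzero entry, at the transposed
    position, of its inverse \<open>G ** matrix_inv H\<close>, so the growth rates compare in both
    directions.\<close>
  have eq: "e i = d j" if "K $ i $ j \<noteq> 0" for i j
    using exponent_le[OF G le(2), of i j] exponent_le[OF H le(1), of j i] that K'
    unfolding K_def[symmetric] by force
  have "diag_matrix (\<lambda>i. exp (t * e i)) ** K = K ** diag_matrix (\<lambda>i. exp (t * d i))" for t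
  proof -
    have "exp (t * e i) * K $ i $ j = K $ i $ j * exp (t * d j)" for i j
      using eq[of i j] by (cases "K $ i $ j = 0") auto
    then show ?thesis
      by (simp add: vec_eq_iff diag_matrix_mult_left diag_matrix_mult_right)
  qed
  then have "congr_diag H (\<lambda>i. exp (t * e i)) = congr_diag G (\<lambda>i. exp (t * d i))" for t
    unfolding congr_diag_def HK matrix_transpose_mul
    by (metis KK matrix_mul_assoc matrix_mul_lid)
  then show ?thesis by (simp add: diag_ray_def)
qed

lemma diag_ray_0: "diag_ray G d 0 = transpose G ** G"
  by (simp add: diag_ray_def congr_diag_1)

lemma asymptotic_unique:
  fixes \<gamma>1 \<gamma>2 :: "real \<Rightarrow> real ^ 'n::{finite,linorder} ^ 'n::{finite,linorder}"
  assumes as: "(\<gamma>1, \<gamma>2) \<in> asymptotic" and start: "\<gamma>1 0 = \<gamma>2 0"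
  shows "\<gamma>1 = \<gamma>2"
proof -
  obtain C where "\<gamma>1 \<in> geodesic_rays" "\<gamma>2 \<in> geodesic_rays"
    and C: "\<And>t. t \<ge> 0 \<Longrightarrow> form_le C (\<gamma>1 t) (\<gamma>2 t) \<and> form_le C (\<gamma>2 t) (\<gamma>1 t)"
    using as unfolding asymptotic_iff by blast
  then obtain G d H e where "invertible G" "\<gamma>1 = diag_ray G d" "invertible H" "\<gamma>2 = diag_ray H e"
    using geodesic_ray_diag by metis
  then show ?thesis
    using diag_ray_unique[of G H C d e] C start by (simp add: diag_ray_0)
qed

section \<open>The Gram-Schmidt process and asymptotic rays\<close>

text \<open>The two existential facts describe the triangular change of basis in both directions.
  All four are proved together because the vector at \<open>k\<close> is built from orthonormal
  predecessors lying in the span of earlier columns.\<close>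

lemma gram_schmidt_props:
  fixes W :: "real ^ 'n::{finite,linorder} ^ 'n::{finite,linorder}"
  assumes W: "invertible W"
  defines "u \<equiv> gram_schmidt (\<lambda>j. column j W)"
  shows "norm (u k) = 1 \<and> (\<forall>j<k. u k \<bullet> u j = 0) \<and>
    (\<exists>c. u k = W *v c \<and> (\<forall>i>k. c $ i = 0)) \<and>
    (\<exists>a b. column k W = a *\<^sub>R u k + (\<Sum>j\<in>{..<k}. b j *\<^sub>R u j))"
proof (induction k rule: measure_induct_rule[of "\<lambda>k. card {..<k}"])
  case (less k)
  have IH: "norm (u j) = 1" "\<And>i. i < j \<Longrightarrow> u j \<bullet> u i = 0"
    "\<exists>c. u j = W *v c \<and> (\<forall>i>j. c $ i = 0)" if "j < k" for j
  proof -
    have "{..<j} \<subset> {..<k}" using that by auto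
    then have "card {..<j} < card {..<k}" by (simp add: psubset_card_mono)
    from less[OF this] show "norm (u j) = 1" "\<And>i. i < j \<Longrightarrow> u j \<bullet> u i = 0"
      "\<exists>c. u j = W *v c \<and> (\<forall>i>j. c $ i = 0)" by auto
  qed
  have orth: "u i \<bullet> u j = (if i = j then 1 else 0)" if "i < k" "j < k" for i j
    using IH(1)[OF that(1)] IH(2)[OF that(1), of j] IH(2)[OF that(2), of i]
    by (cases i j rule: linorder_cases) (auto simp: inner_commute norm_eq_1)
  define b where "b j = column k W \<bullet> u j" for j
  define v where "v = column k W - (\<Sum>j\<in>{..<k}. b j *\<^sub>R u j)"
  have uk: "u k = v /\<^sub>R norm v"
    unfolding u_def by (subst gram_schmidt.simps) (simp add: Let_def v_def b_def u_def)
  obtain c where c: "\<And>j. j < k \<Longrightarrow> u j = W *v c j" "\<And>i j. j < k \<Longrightarrow> i > j \<Longrightarrow> c j $ i = 0"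
    using IH(3) by metis
  \<comment> \<open>Coordinates of the unnormalized vector \<open>v\<close> with respect to the
    columns of \<open>W\<close>. The entry 1 at \<open>k\<close> and invertibility of
    \<open>W\<close> exclude \<open>v = 0\<close>, so the normalization does not divide by
    zero.\<close>
  define a where "a = axis k 1 - (\<Sum>j\<in>{..<k}. b j *\<^sub>R c j)"
  have "v = W *v a"
    using c(1) by (simp add: v_def a_def matrix_vector_mult_diff_distrib matrix_vector_mult_basis
        linear_sum[OF matrix_vector_mul_linear] matrix_vector_mult_scaleR)
  have "a $ i = (if i = k then 1 else 0)" if "i \<ge> k" for i
    using c(2)[of _ i] that by (auto simp: a_def axis_def)
  then have a: "a $ k = 1" "\<And>i. i > k \<Longrightarrow> a $ i = 0" by auto
  have v0: "v \<noteq> 0"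
    using a(1) unfolding \<open>v = W *v a\<close> invertible_mult_vec_eq_0[OF W] by auto
  have "v \<bullet> u j = 0" if "j < k" for j
  proof -
    have "(\<Sum>i\<in>{..<k}. b i * (u i \<bullet> u j)) = (\<Sum>i\<in>{..<k}. if i = j then b i else 0)"
      using orth that by (intro sum.cong) auto
    then show ?thesis
      using that by (simp add: v_def inner_diff inner_sum_left) (simp add: b_def)
  qed
  then have "\<forall>j<k. u k \<bullet> u j = 0" by (simp add: uk)
  moreover have "norm (u k) = 1" using v0 by (simp add: uk)
  moreover have "u k = W *v (a /\<^sub>R norm v)"
    by (simp add: uk \<open>v = W *v a\<close> matrix_vector_mult_scaleR)
  then have "\<exists>c. u k = W *v c \<and> (\<forall>i>k. c $ i = 0)"
    using a(2) by (intro exI[of _ "a /\<^sub>R norm v"]) auto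
  moreover have "column k W = norm v *\<^sub>R u k + (\<Sum>j\<in>{..<k}. b j *\<^sub>R u j)"
    using v0 by (simp add: uk) (simp add: v_def)
  ultimately show ?case by blast
qed

text \<open>The QR decomposition: \<open>transpose U ** W\<close> is the triangular factor and
  \<open>matrix_inv W ** U\<close> its inverse. The first is triangular because column
  \<open>j\<close> of \<open>W\<close> is a combination of the \<open>u l\<close> with
  \<open>l \<le> j\<close>, the second because \<open>u j\<close> is a combination of the columns of
  \<open>W\<close> up to \<open>j\<close>.\<close>

lemma gram_schmidt_triangular:
  fixes W U :: "real ^ 'n::{finite,linorder} ^ 'n::{finite,linorder}"
  assumes W: "invertible W" and U: "U = (\<chi> i j. gram_schmidt (\<lambda>j. column j W) j $ i)"
  shows "orthogonal_matrix U" "\<And>i j. j < i \<Longrightarrow> (transpose U ** W) $ i $ j = 0"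
    "\<And>i j. j < i \<Longrightarrow> (matrix_inv W ** U) $ i $ j = 0"
proof -
  define u where "u = gram_schmidt (\<lambda>j. column j W)"
  note gs = gram_schmidt_props[OF W, folded u_def]
  have col: "column j U = u j" for j
    by (simp add: U u_def column_def vec_eq_iff)
  have orth: "i \<noteq> j \<Longrightarrow> u i \<bullet> u j = 0" for i j
    using gs[of i] gs[of j] by (cases i j rule: linorder_cases) (auto simp: inner_commute)
  show "orthogonal_matrix U"
    unfolding orthogonal_matrix_orthonormal_columns col orthogonal_def using gs orth by auto
  show "(transpose U ** W) $ i $ j = 0" if "j < i" for i j
  proof -
    obtain a b where w: "column j W = a *\<^sub>R u j + (\<Sum>l\<in>{..<j}. b l *\<^sub>R u l)"
      using gs[of j] by blast
    have "u i \<bullet> u l = 0" if "l \<le> j" for l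
      using that \<open>j < i\<close> by (intro orth) auto
    then have "column i U \<bullet> column j W = 0"
      by (simp add: col w inner_add inner_sum_right)
    then show ?thesis
      by (simp add: matrix_matrix_mult_def transpose_def column_def inner_vec_def)
  qed
  show "(matrix_inv W ** U) $ i $ j = 0" if "j < i" for i j
  proof -
    obtain c where c: "u j = W *v c" "c $ i = 0" using gs[of j] \<open>j < i\<close> by blast
    have "(matrix_inv W ** U) $ i $ j = (matrix_inv W *v u j) $ i"
      using col[of j] by (simp add: matrix_matrix_mult_def matrix_vector_mult_def column_def vec_eq_iff)
    also have "matrix_inv W *v u j = c"
      by (simp add: c(1) matrix_vector_mul_assoc inv_cancel[OF W])
    finally show ?thesis using c(2) by simp
  qed
qed

text \<open>This is where the order of the eigenvalues enters: conjugation of an upper triangular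
  matrix by \<open>exp (t D / 2)\<close> has entries \<open>R $ i $ j * exp (t * (d j - d i) / 2)\<close>, which are
  bounded for \<open>t \<ge> 0\<close>.\<close>

lemma form_le_triangular:
  fixes R H :: "real ^ 'n::{finite,linorder} ^ 'n::{finite,linorder}"
  assumes R: "\<And>i j. j < i \<Longrightarrow> R $ i $ j = 0" and d: "antimono d" and t: "t \<ge> 0"
  shows "form_le (\<Sum>i\<in>UNIV. \<Sum>j\<in>UNIV. (R $ j $ i)\<^sup>2) (diag_ray (transpose R ** H) d t) (diag_ray H d t)"
  unfolding form_le_def
proof
  fix v
  define h where "h = H *v v"
  define Q where "Q = (\<Sum>j\<in>UNIV. exp (t * d j) * (h $ j)\<^sup>2)"
  have "exp (t * d i) * ((transpose R *v h) $ i)\<^sup>2 \<le> (\<Sum>j\<in>UNIV. (R $ j $ i)\<^sup>2) * Q" for i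
  proof -
    have "(transpose R *v h) $ i = (\<Sum>j\<in>{..i}. R $ j $ i * h $ j)"
      unfolding matrix_vector_mult_def transpose_def
      by (simp, rule sum.mono_neutral_right) (use R in auto)
    then have "((transpose R *v h) $ i)\<^sup>2 \<le> (\<Sum>j\<in>{..i}. (R $ j $ i)\<^sup>2) * (\<Sum>j\<in>{..i}. (h $ j)\<^sup>2)"
      by (simp add: Cauchy_Schwarz_ineq_sum)
    then have "exp (t * d i) * ((transpose R *v h) $ i)\<^sup>2
      \<le> (\<Sum>j\<in>{..i}. (R $ j $ i)\<^sup>2) * (\<Sum>j\<in>{..i}. exp (t * d i) * (h $ j)\<^sup>2)"
      by (simp add: mult.left_commute flip: sum_distrib_left)
    also have "\<dots> \<le> (\<Sum>j\<in>UNIV. (R $ j $ i)\<^sup>2) * Q"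
    proof (intro mult_mono)
      \<comment> \<open>Only indices \<open>j \<le> i\<close> survive by triangularity, and there
        \<open>d i \<le> d j\<close>; so the weight of row \<open>i\<close> is absorbed into the
        weights of the form on the right.\<close>
      have "(\<Sum>j\<in>{..i}. exp (t * d i) * (h $ j)\<^sup>2) \<le> (\<Sum>j\<in>{..i}. exp (t * d j) * (h $ j)\<^sup>2)"
        using d t by (intro sum_mono mult_right_mono) (auto simp: antimono_def mult_left_mono)
      also have "\<dots> \<le> Q"
        unfolding Q_def by (intro sum_mono2) auto
      finally show "(\<Sum>j\<in>{..i}. exp (t * d i) * (h $ j)\<^sup>2) \<le> Q" .
    qed (auto intro: sum_mono2 sum_nonneg)
    finally show ?thesis .
  qed
  then have "(\<Sum>i\<in>UNIV. exp (t * d i) * ((transpose R *v h) $ i)\<^sup>2) \<le> (\<Sum>i\<in>UNIV. \<Sum>j\<in>UNIV. (R $ j $ i)\<^sup>2) * Q"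
    unfolding sum_distrib_right[of _ _ Q] by (rule sum_mono)
  then show "v \<bullet> (diag_ray (transpose R ** H) d t *v v)
      \<le> (\<Sum>i\<in>UNIV. \<Sum>j\<in>UNIV. (R $ j $ i)\<^sup>2) * (v \<bullet> (diag_ray H d t *v v))"
    using t by (simp add: diag_ray_def quadratic_form_congr_diag h_def Q_def
        flip: matrix_vector_mul_assoc del: transpose_matrix_vector)
qed

text \<open>The triangular factor of \<open>W\<close> relates \<open>G\<close> and \<open>H\<close>,
  and its inverse relates them in the opposite direction; both being upper triangular,
  \<open>form_le_triangular\<close> yields the two comparisons.\<close>

lemma asymptotic_diag_ray:
  fixes x G W U H :: "real ^ 'n::{finite,linorder} ^ 'n::{finite,linorder}"
  assumes x: "x \<in> spd_matrices" and G: "invertible G"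
    and d: "antimono d" "(\<Sum>i\<in>UNIV. (d i)\<^sup>2) = 1"
    and W: "W = matrix_inv (spd_sqrt x) ** transpose G"
    and U: "U = (\<chi> i j. gram_schmidt (\<lambda>j. column j W) j $ i)"
    and H: "H = transpose U ** spd_sqrt x"
  shows "(diag_ray G d, diag_ray H d) \<in> asymptotic" "diag_ray H d 0 = x"
proof -
  note s = spd_sqrt_invertible_sym[OF x]
  have iW: "invertible W"
    unfolding W by (intro invertible_mult invertible_matrix_inv transpose_invertible s G)
  note gs = gram_schmidt_triangular[OF iW U]
  have iH: "invertible H"
    unfolding H by (intro invertible_mult s orthogonal_matrix_inv(2)) (simp add: gs)
  have UU: "U ** transpose U = mat 1" using gs(1) by (simp add: orthogonal_matrix_def)
  have Gs: "G = transpose W ** spd_sqrt x"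
    by (simp add: W matrix_transpose_mul s inv_cancel[OF s(1)])
  have "transpose (transpose U ** W) ** H = transpose W ** (U ** transpose U) ** spd_sqrt x"
    by (simp add: H matrix_transpose_mul matrix_mul_assoc)
  then have GH: "G = transpose (transpose U ** W) ** H" by (simp add: UU Gs)
  have "transpose (matrix_inv W ** U) ** G = transpose U ** transpose (matrix_inv W) ** transpose W ** spd_sqrt x"
    by (simp add: Gs matrix_transpose_mul matrix_mul_assoc)
  then have HG: "H = transpose (matrix_inv W ** U) ** G" by (simp add: H inv_cancel[OF iW])
  define C where "C = (\<Sum>i\<in>UNIV. \<Sum>j\<in>UNIV. ((transpose U ** W) $ j $ i)\<^sup>2)"
  define C' where "C' = (\<Sum>i\<in>UNIV. \<Sum>j\<in>UNIV. ((matrix_inv W ** U) $ j $ i)\<^sup>2)"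
  have le: "form_le C (diag_ray G d t) (diag_ray H d t)" "form_le C' (diag_ray H d t) (diag_ray G d t)"
    if "t \<ge> 0" for t
    using form_le_triangular[OF gs(2) d(1) that, of H, folded C_def GH]
      form_le_triangular[OF gs(3) d(1) that, of G, folded C'_def HG] by auto
  have rays: "diag_ray G d \<in> geodesic_rays" "diag_ray H d \<in> geodesic_rays"
    using G iH d(2) diag_ray_geodesic by blast+
  \<comment> \<open>One factor must serve both comparisons; enlarging it is harmless since the
    dominating form is nonnegative.\<close>
  have mono: "form_le (max C C') y z" if "form_le C y z \<or> form_le C' y z" "z \<in> spd_matrices"
    for y z :: "real ^ 'n::{finite,linorder} ^ 'n::{finite,linorder}"
    unfolding form_le_def
  proof
    fix v
    have "v \<bullet> (z *v v) \<ge> 0" using that(2) by (cases "v = 0") (auto simp: spd_matrices_def less_imp_le)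
    then have "C * (v \<bullet> (z *v v)) \<le> max C C' * (v \<bullet> (z *v v))" "C' * (v \<bullet> (z *v v)) \<le> max C C' * (v \<bullet> (z *v v))"
      by (simp_all add: mult_right_mono)
    then show "v \<bullet> (y *v v) \<le> max C C' * (v \<bullet> (z *v v))"
      using that(1) unfolding form_le_def by (metis order_trans)
  qed
  have "max C C' \<ge> 0" by (simp add: C_def le_max_iff_disj sum_nonneg)
  then show "(diag_ray G d, diag_ray H d) \<in> asymptotic"
    unfolding asymptotic_iff using rays le mono geodesic_rays_spd by blast
  show "diag_ray H d 0 = x"
    using spd_sqrt(2)[OF x] UU
    by (metis H diag_ray_0 matrix_mul_assoc matrix_mul_rid matrix_transpose_mul s(2) transpose_transpose)
qed

section \<open>Rays of a boundary point and its radial field\<close>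

lemma boundary_asymptotic:
  fixes \<xi> :: "(real \<Rightarrow> real ^ 'n::{finite,linorder} ^ 'n::{finite,linorder}) set"
  assumes "\<xi> \<in> boundary_at_infinity" "\<gamma> \<in> \<xi>"
  shows "\<gamma>' \<in> \<xi> \<longleftrightarrow> (\<gamma>, \<gamma>') \<in> asymptotic"
proof -
  obtain \<gamma>0 where "\<xi> = asymptotic `` {\<gamma>0}"
    using assms(1) unfolding boundary_at_infinity_def quotient_def by blast
  then show ?thesis
    using assms(2) asymptotic_sym asymptotic_trans by (auto dest: symD transD)
qed

lemma ray_from_eq:
  fixes \<xi> :: "(real \<Rightarrow> real ^ 'n::{finite,linorder} ^ 'n::{finite,linorder}) set"
  assumes "\<xi> \<in> boundary_at_infinity" "\<gamma> \<in> \<xi>"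
  shows "ray_from \<xi> (\<gamma> 0) = \<gamma>"
  unfolding ray_from_def
proof (rule the_equality)
  show "\<gamma>' = \<gamma>" if "\<gamma>' \<in> \<xi> \<and> \<gamma>' 0 = \<gamma> 0" for \<gamma>'
    using asymptotic_unique[of \<gamma> \<gamma>'] boundary_asymptotic[OF assms] that by simp
qed (use assms in simp)

lemma ray_from_mem:
  fixes \<xi> :: "(real \<Rightarrow> real ^ 'n::{finite,linorder} ^ 'n::{finite,linorder}) set"
  assumes \<xi>: "\<xi> \<in> boundary_at_infinity" and x: "x \<in> spd_matrices"
  shows "ray_from \<xi> x \<in> \<xi>" "ray_from \<xi> x 0 = x"
proof -
  obtain \<gamma>0 where \<gamma>0: "\<gamma>0 \<in> geodesic_rays" "\<xi> = asymptotic `` {\<gamma>0}"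
    using \<xi> unfolding boundary_at_infinity_def quotient_def by blast
  obtain G d where "invertible G" "antimono d" "(\<Sum>i\<in>UNIV. (d i)\<^sup>2) = 1" "\<gamma>0 = diag_ray G d"
    using geodesic_ray_diag[OF \<gamma>0(1)] .
  \<comment> \<open>Existence of a ray from \<open>x\<close> in the class: Gram-Schmidt applied to
    any representative, in sorted normal form, produces one.\<close>
  from asymptotic_diag_ray[OF x this(1-3) refl refl refl] this(4)
  obtain \<gamma> where "\<gamma> \<in> \<xi>" "\<gamma> 0 = x"
    unfolding \<gamma>0(2) by blast
  then show "ray_from \<xi> x \<in> \<xi>" "ray_from \<xi> x 0 = x"
    using ray_from_eq[OF \<xi>] by auto
qed

lemma boundary_geodesic:
  fixes \<xi> :: "(real \<Rightarrow> real ^ 'n::{finite,linorder} ^ 'n::{finite,linorder}) set"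
  assumes "\<xi> \<in> boundary_at_infinity" "\<gamma> \<in> \<xi>"
  shows "\<gamma> \<in> geodesic_rays"
  using assms unfolding boundary_at_infinity_def quotient_def asymptotic_def by blast

lemma radial_field_eq:
  assumes "(ray_from \<xi> x has_vector_derivative v) (at 0 within {0..})"
  shows "radial_field \<xi> x = v"
  unfolding radial_field_def
  by (rule vector_derivative_within) (use assms in \<open>auto simp: at_within_Ici_at_right\<close>)

theorem theorem2p1:
  fixes p z x V W U :: "real ^ 'n::{finite,linorder} ^ 'n::{finite,linorder}"
    and \<xi> :: "(real \<Rightarrow> real ^ 'n::{finite,linorder} ^ 'n::{finite,linorder}) set"
    and d :: "'n \<Rightarrow> real"
    and u :: "'n \<Rightarrow> real ^ 'n::{finite,linorder}"
  assumes "p \<in> spd_matrices"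
    and "z \<in> unit_tangent p"
    and "\<xi> \<in> boundary_at_infinity" and "radial_field \<xi> p = z"
    and "orthogonal_matrix V" and "antimono d"
    and "V ** diag_matrix d ** transpose V
           = matrix_inv (spd_sqrt p) ** radial_field \<xi> p ** matrix_inv (spd_sqrt p)"
    and "x \<in> spd_matrices"
    and "W = matrix_inv (spd_sqrt x) ** spd_sqrt p ** V"
    and "u = gram_schmidt (\<lambda>j. column j W)"
    and "U = (\<chi> i j. u j $ i)"
  shows "radial_field \<xi> x = spd_sqrt x ** U ** diag_matrix d ** transpose U ** spd_sqrt x"
proof -
  note p = assms(1) and \<xi> = assms(3) and V = assms(5) and x = assms(8)
  note sp = spd_sqrt_invertible_sym[OF p] and sx = spd_sqrt_invertible_sym[OF x]
  \<comment> \<open>This \<open>G\<close> diagonalizes the data at \<open>p\<close>: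
    \<open>transpose G ** G\<close> is \<open>p\<close>, and \<open>congr_diag G d\<close> is the
    radial field there.\<close>
  define G where "G = transpose V ** spd_sqrt p"
  define \<gamma> where "\<gamma> = ray_from \<xi> p"
  have \<gamma>: "\<gamma> \<in> \<xi>" "\<gamma> 0 = p" unfolding \<gamma>_def by (rule ray_from_mem[OF \<xi> p])+
  have \<gamma>_geo: "\<gamma> \<in> geodesic_rays" by (rule boundary_geodesic[OF \<xi> \<gamma>(1)])
  have G: "invertible G"
    unfolding G_def by (intro invertible_mult sp orthogonal_matrix_inv(2)) (simp add: V)
  have Gp: "transpose G ** G = p"
    using V spd_sqrt(2)[OF p] sp(2) unfolding G_def orthogonal_matrix_def
    by (metis matrix_mul_assoc matrix_mul_rid matrix_transpose_mul transpose_transpose)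
  have "congr_diag G d = spd_sqrt p ** (V ** diag_matrix d ** transpose V) ** spd_sqrt p"
    by (simp add: congr_diag_def G_def matrix_transpose_mul sp matrix_mul_assoc)
  also have "\<dots> = radial_field \<xi> p"
    unfolding assms(7) by (simp add: matrix_mul_assoc inv_cancel[OF sp(1)])
  finally have Gd: "congr_diag G d = radial_field \<xi> p" .
  \<comment> \<open>\<open>radial_field\<close> is a total function, so actual differentiability of
    the ray at 0 comes from the geodesic equation before its value can be used as a
    velocity.\<close>
  obtain v where "(\<gamma> has_vector_derivative v) (at 0 within {0..})"
    using \<gamma>_geo unfolding geodesic_rays_def by force
  then have "(\<gamma> has_vector_derivative congr_diag G d) (at 0 within {0..})"
    using radial_field_eq[of \<xi> p] Gd \<gamma>_def by simp
  note diag = geodesic_ray_eq_diag_ray[OF \<gamma>_geo G _ this, unfolded \<gamma>(2) Gp, OF refl]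
  define H where "H = transpose U ** spd_sqrt x"
  \<comment> \<open>In terms of \<open>G\<close>, the matrix \<open>W\<close> is the one
    orthonormalized in \<open>asymptotic_diag_ray\<close>, so the ray from \<open>x\<close> is
    \<open>diag_ray H d\<close>; its initial velocity \<open>congr_diag H d\<close> is the claimed
    formula.\<close>
  have "W = matrix_inv (spd_sqrt x) ** transpose G"
    by (simp add: assms(9) G_def matrix_transpose_mul sp matrix_mul_assoc)
  from asymptotic_diag_ray[OF x G assms(6) diag(2) this assms(11)[unfolded assms(10)] H_def]
  have "ray_from \<xi> x = diag_ray H d"
    using ray_from_eq[OF \<xi>, of "diag_ray H d"] boundary_asymptotic[OF \<xi> \<gamma>(1)] diag(1) by simp
  with diag_ray_derivative[of 0 H d] have "radial_field \<xi> x = congr_diag H d"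
    by (intro radial_field_eq) simp
  then show ?thesis
    by (simp add: congr_diag_def H_def matrix_transpose_mul sx matrix_mul_assoc)
qed

end
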